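(* For every loopless matroid $M$, the volume polynomial $VP^\nabla_M\in\mathbb R[t_F: F\in\mathscr L_M^{\ge2}]$ is Lorentzian.
   Context: $M$ is a loopless matroid of rank $d+1$ on $E$, $\mathscr L_M^{\ge2}$ its set of flats of rank $\ge2$. $A^\bullet(M)=\mathbb R[x_F: F\text{ nonempty proper flat}]/(\langle x_Fx_{F'}: F,F'\text{ incomparable}\rangle+\langle\sum_{F\ni i}x_F-\sum_{F\ni j}x_F\rangle)$ with degree map $\int_M x_{F_1}\cdots x_{F_d}=1$ for maximal chains; $h_F=\alpha-\sum_{F\subseteq G\subsetneq E}x_G$ with $\alpha=\sum_{G\ni i}x_G$; $VP^\nabla_M(\underline t)=\int_M(\sum_{F\in\mathscr L_M^{\ge2}}t_Fh_F)^d$. A homogeneous polynomial $f\in\mathbb R[x_1,\dots,x_m]$ of degree $d$ is strictly Lorentzian if all degree-$d$ monomials appear with positive coefficients and the Hessian of every $(d-2)$-nd order partial derivative $\partial_{i_1}\cdots\partial_{i_{d-2}}f$ has signature $(+,-,\dots,-)$; Lorentzian polynomials are limits of strictly Lorentzian polynomials (equivalently, for $f$ with nonnegative coefficients: the support of $f$ is M-convex and every Hessian of a $(d-2)$-nd partial derivative has at most one positive eigenvalue). *)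

theory Defs
  imports Complex_Main "HOL-Library.Poly_Mapping" "HOL-Library.Multiset"
    "Jordan_Normal_Form.Char_Poly"
begin

definition matroid :: "'a set \<Rightarrow> ('a set \<Rightarrow> bool) \<Rightarrow> bool" where
  "matroid E indep \<longleftrightarrow> finite E \<and> indep {} \<and> (\<forall>X. indep X \<longrightarrow> X \<subseteq> E)
     \<and> (\<forall>X Y. indep Y \<and> X \<subseteq> Y \<longrightarrow> indep X)
     \<and> (\<forall>X Y. indep X \<and> indep Y \<and> card X < card Y \<longrightarrow> (\<exists>y\<in>Y - X. indep (insert y X)))"

definition mrank :: "('a set \<Rightarrow> bool) \<Rightarrow> 'a set \<Rightarrow> nat" where
  "mrank indep X = Max (card ` {Y. Y \<subseteq> X \<and> indep Y})"

definition loopless :: "'a set \<Rightarrow> ('a set \<Rightarrow> bool) \<Rightarrow> bool" where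
  "loopless E indep \<longleftrightarrow> (\<forall>e\<in>E. indep {e})"

definition is_flat :: "'a set \<Rightarrow> ('a set \<Rightarrow> bool) \<Rightarrow> 'a set \<Rightarrow> bool" where
  "is_flat E indep F \<longleftrightarrow> F \<subseteq> E \<and> (\<forall>e\<in>E - F. mrank indep F < mrank indep (insert e F))"

definition np_flats :: "'a set \<Rightarrow> ('a set \<Rightarrow> bool) \<Rightarrow> 'a set set" where
  "np_flats E indep = {F. is_flat E indep F \<and> F \<noteq> {} \<and> F \<noteq> E}"

definition flats_ge2 :: "'a set \<Rightarrow> ('a set \<Rightarrow> bool) \<Rightarrow> 'a set set" where
  "flats_ge2 E indep = {F. is_flat E indep F \<and> 2 \<le> mrank indep F}"

type_synonym 'v rpoly = "('v \<Rightarrow>\<^sub>0 nat) \<Rightarrow>\<^sub>0 real"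

definition pvar :: "'v \<Rightarrow> ('v \<Rightarrow>\<^sub>0 nat) \<Rightarrow>\<^sub>0 'b::{zero,one}" where
  "pvar v = Poly_Mapping.single (Poly_Mapping.single v 1) 1"

definition mdeg :: "('v \<Rightarrow>\<^sub>0 nat) \<Rightarrow> nat" where
  "mdeg m = sum (Poly_Mapping.lookup m) (Poly_Mapping.keys m)"

definition homog :: "nat \<Rightarrow> (('v \<Rightarrow>\<^sub>0 nat) \<Rightarrow>\<^sub>0 'b::zero) \<Rightarrow> bool" where
  "homog d p \<longleftrightarrow> (\<forall>m\<in>Poly_Mapping.keys p. mdeg m = d)"

definition vars_in :: "'v set \<Rightarrow> (('v \<Rightarrow>\<^sub>0 nat) \<Rightarrow>\<^sub>0 'b::zero) \<Rightarrow> bool" where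
  "vars_in V p \<longleftrightarrow> (\<forall>m\<in>Poly_Mapping.keys p. Poly_Mapping.keys m \<subseteq> V)"

definition pderiv_var :: "'v \<Rightarrow> 'v rpoly \<Rightarrow> 'v rpoly" where
  "pderiv_var v p = (\<Sum>m\<in>Poly_Mapping.keys p.
      Poly_Mapping.single (m - Poly_Mapping.single v 1)
        (of_nat (Poly_Mapping.lookup m v) * Poly_Mapping.lookup p m))"

definition chow_gens :: "'a set \<Rightarrow> ('a set \<Rightarrow> bool) \<Rightarrow> 'a set rpoly set" where
  "chow_gens E indep =
     {pvar F * pvar G | F G. F \<in> np_flats E indep \<and> G \<in> np_flats E indep \<and> \<not> F \<subseteq> G \<and> \<not> G \<subseteq> F}
   \<union> {(\<Sum>F\<in>{F\<in>np_flats E indep. i \<in> F}. pvar F) - (\<Sum>F\<in>{F\<in>np_flats E indep. j \<in> F}. pvar F)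
        | i j. i \<in> E \<and> j \<in> E}"

inductive_set chow_ideal :: "'a set \<Rightarrow> ('a set \<Rightarrow> bool) \<Rightarrow> 'a set rpoly set"
  for E indep where
  zero: "0 \<in> chow_ideal E indep"
| step: "\<lbrakk>g \<in> chow_gens E indep; vars_in (np_flats E indep) q; p \<in> chow_ideal E indep\<rbrakk>
         \<Longrightarrow> q * g + p \<in> chow_ideal E indep"

definition chow_deg :: "'a set \<Rightarrow> ('a set \<Rightarrow> bool) \<Rightarrow> nat \<Rightarrow> 'a set rpoly \<Rightarrow> bool" where
  "chow_deg E indep d p \<longleftrightarrow> vars_in (np_flats E indep) p \<and> homog d p"

definition is_degree_map :: "'a set \<Rightarrow> ('a set \<Rightarrow> bool) \<Rightarrow> nat \<Rightarrow> ('a set rpoly \<Rightarrow> real) \<Rightarrow> bool" where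
  "is_degree_map E indep d \<phi> \<longleftrightarrow>
     (\<forall>p q. chow_deg E indep d p \<and> chow_deg E indep d q \<longrightarrow> \<phi> (p + q) = \<phi> p + \<phi> q)
   \<and> (\<forall>c p. chow_deg E indep d p \<longrightarrow> \<phi> (Poly_Mapping.single 0 c * p) = c * \<phi> p)
   \<and> (\<forall>p. \<not> chow_deg E indep d p \<longrightarrow> \<phi> p = 0)
   \<and> (\<forall>p\<in>chow_ideal E indep. chow_deg E indep d p \<longrightarrow> \<phi> p = 0)
   \<and> (\<forall>Fs. length Fs = d \<and> set Fs \<subseteq> np_flats E indep \<and> sorted_wrt (\<subset>) Fs
          \<longrightarrow> \<phi> (prod_list (map pvar Fs)) = 1)"

text \<open>the degree map on A^d(M), lifted to degree-d polynomials (and 0 elsewhere)\<close>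
definition chow_integral :: "'a set \<Rightarrow> ('a set \<Rightarrow> bool) \<Rightarrow> nat \<Rightarrow> 'a set rpoly \<Rightarrow> real" where
  "chow_integral E indep d = (THE \<phi>. is_degree_map E indep d \<phi>)"

definition chow_alpha :: "'a set \<Rightarrow> ('a set \<Rightarrow> bool) \<Rightarrow> 'a set rpoly" where
  "chow_alpha E indep = (\<Sum>G\<in>{G\<in>np_flats E indep. (SOME i. i \<in> E) \<in> G}. pvar G)"

definition chow_h :: "'a set \<Rightarrow> ('a set \<Rightarrow> bool) \<Rightarrow> 'a set \<Rightarrow> 'a set rpoly" where
  "chow_h E indep F = chow_alpha E indep - (\<Sum>G\<in>{G\<in>np_flats E indep. F \<subseteq> G}. pvar G)"

text \<open>VP(t) = integral of (sum_F t_F h_F)^d, a polynomial in the variables t_F, F of rank >= 2\<close>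
definition volume_poly :: "'a set \<Rightarrow> ('a set \<Rightarrow> bool) \<Rightarrow> nat \<Rightarrow> 'a set rpoly" where
  "volume_poly E indep d =
     Poly_Mapping.map (chow_integral E indep d)
       ((\<Sum>F\<in>flats_ge2 E indep. Poly_Mapping.single (Poly_Mapping.single F 1) (chow_h E indep F)) ^ d)"

definition var_enum :: "'v set \<Rightarrow> 'v list" where
  "var_enum V = (SOME vs. distinct vs \<and> set vs = V)"

definition hessian :: "'v set \<Rightarrow> 'v rpoly \<Rightarrow> real mat" where
  "hessian V g = (let vs = var_enum V in
     mat (length vs) (length vs)
       (\<lambda>(j, k). Poly_Mapping.lookup (pderiv_var (vs ! j) (pderiv_var (vs ! k) g)) 0))"

definition signature_lorentz :: "nat \<Rightarrow> real mat \<Rightarrow> bool" where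
  "signature_lorentz n H \<longleftrightarrow> (\<exists>R :: real multiset.
     char_poly H = prod_mset (image_mset (\<lambda>r. [:- r, 1:]) R)
     \<and> size (filter_mset (\<lambda>r. 0 < r) R) = 1
     \<and> size (filter_mset (\<lambda>r. r < 0) R) = n - 1)"

definition deg_monomials :: "'v set \<Rightarrow> nat \<Rightarrow> ('v \<Rightarrow>\<^sub>0 nat) set" where
  "deg_monomials V d = {m. Poly_Mapping.keys m \<subseteq> V \<and> mdeg m = d}"

definition strictly_lorentzian :: "'v set \<Rightarrow> nat \<Rightarrow> 'v rpoly \<Rightarrow> bool" where
  "strictly_lorentzian V d f \<longleftrightarrow>
     Poly_Mapping.keys f \<subseteq> deg_monomials V d
   \<and> (\<forall>m\<in>deg_monomials V d. 0 < Poly_Mapping.lookup f m)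
   \<and> (2 \<le> d \<longrightarrow> (\<forall>is. length is = d - 2 \<and> set is \<subseteq> V \<longrightarrow>
          signature_lorentz (card V) (hessian V (foldr pderiv_var is f))))"

definition lorentzian :: "'v set \<Rightarrow> nat \<Rightarrow> 'v rpoly \<Rightarrow> bool" where
  "lorentzian V d f \<longleftrightarrow> (\<exists>fs :: nat \<Rightarrow> 'v rpoly.
     (\<forall>k. strictly_lorentzian V d (fs k))
   \<and> (\<forall>m. (\<lambda>k. Poly_Mapping.lookup (fs k) m) \<longlonglongrightarrow> Poly_Mapping.lookup f m))"

end

theory Submission
  imports Defs "Jordan_Normal_Form.Schur_Decomposition"
begin

text \<open>Expressed in the classes \<open>h\<^sub>F\<close>, the degree map is combinatorial: multiplying by \<open>h\<^sub>F\<close> amounts to the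
  principal truncation of the matroid along \<open>F\<close>, so the integral of \<open>h\<^bsub>F\<^sub>1\<^esub> \<cdots> h\<^bsub>F\<^sub>d\<^esub>\<close> is \<open>1\<close> if the successive
  truncations are all nontrivial and \<open>0\<close> otherwise. That this functional respects the relations of the
  Chow ring reduces, by truncating, to rank three. Hence the coefficient of \<open>t\<^sup>m\<close> in the volume polynomial
  is \<open>d! / m!\<close> when the truncation along \<open>m\<close> has rank one, and zero otherwise.

  To approximate it by strictly Lorentzian polynomials, skip the trivial truncations, let \<open>\<rho>(m)\<close> be the
  rank that remains after truncating along \<open>m\<close>, and take the coefficients
  \<open>d! / m! \<cdot> \<epsilon>\<^bsup>\<rho>(m) - 1\<^esup> \<cdot> q\<^bsup>\<Sum> m\<^sub>i\<^sup>2\<^esup>\<close> with \<open>\<epsilon>\<close> tending to \<open>0\<close> and \<open>q\<close> tending to \<open>1\<close> from below. Up to diagonal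
  scaling a Hessian is then a rank one form minus a positive semidefinite form coming from parallel
  classes, and the factor \<open>q\<close> lowers the diagonal, which makes the form definite on a hyperplane.\<close>

section \<open>Real symmetric matrices that are negative definite on a hyperplane\<close>

text \<open>\<open>chow_integral\<close> is a definite description, so existence and uniqueness of
  the degree map must both be settled before any coefficient can be computed. Existence is the
  obstacle: on monomials in the generators x_F with repeated factors no values are evident, whereas
  on monomials in the h-classes there is a closed formula. It is therefore taken as the definition
  and carried back to the x_F by Moebius inversion, which leaves the relations to be checked.
  Skipping trivial truncations makes the remaining rank independent of the order, and it stays at
  least one on every monomial. This matters because a strictly Lorentzian polynomial has a positive
  coefficient at every monomial of its degree. The exponent of q is quadratic because the mixed
  second differences of the sum of squares vanish while the pure ones equal 2. In a Hessian it
  therefore contributes a scaling of rows and columns, and one extra factor \<open>q\<^sup>2\<close>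
  on the diagonal.\<close>

lemma symmetric_real_eigenvalue:
  fixes A :: "real mat"
  assumes A: "A \<in> carrier_mat n n" and sym: "A\<^sup>T = A"
    and ev: "eigenvalue (map_mat complex_of_real A) a"
  shows "Im a = 0"
proof -
  let ?C = "map_mat complex_of_real A"
  have C: "?C \<in> carrier_mat n n" using A by simp
  have symC: "?C\<^sup>T = ?C" 
  proof (intro eq_matI)
    fix i j assume "i < dim_row ?C" "j < dim_col ?C"
    thus "?C\<^sup>T $$ (i,j) = ?C $$ (i,j)"
      using A arg_cong[OF sym, of "\<lambda>M. M $$ (i,j)"] by simp
  qed (use A in auto)
  from ev obtain v where v: "v \<in> carrier_vec n" "v \<noteq> 0\<^sub>v n" "?C *\<^sub>v v = a \<cdot>\<^sub>v v"
    unfolding eigenvalue_def eigenvector_def using C by auto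
  let ?w = "conjugate v"
  have w: "?w \<in> carrier_vec n" using v by simp
  have Cw: "?C *\<^sub>v ?w = conjugate a \<cdot>\<^sub>v ?w"
  proof -
    have "?C *\<^sub>v ?w = conjugate (?C *\<^sub>v v)"
      using C v(1) by (intro eq_vecI) (auto simp: scalar_prod_def)
    also have "\<dots> = conjugate a \<cdot>\<^sub>v ?w"
      unfolding v(3) by (rule conjugate_smult_vec)
    finally show ?thesis .
  qed
  have "(?C *\<^sub>v v) \<bullet> ?w = v \<bullet> (?C *\<^sub>v ?w)"
    using transpose_vec_mult_scalar[OF C w v(1)] symC by simp
  hence "a * (v \<bullet> ?w) = conjugate a * (v \<bullet> ?w)"
    unfolding v(3) Cw using v(1) w by (simp)
  moreover have "v \<bullet> ?w \<noteq> 0"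
    using conjugate_square_eq_0_vec[OF v(1)] v(2) by auto
  ultimately have "a = cnj a" by simp
  thus ?thesis by (metis complex_cnj_cancel_iff cnj.simps(2) equal_neg_zero)
qed

text \<open>\<open>signature_lorentz\<close> asks for linear factors over the reals. The complex
  factorization has real roots, and it descends because \<open>complex_of_real\<close> is injective
  on polynomials.\<close>

lemma symmetric_char_poly_splits:
  fixes A :: "real mat"
  assumes A: "A \<in> carrier_mat n n" and sym: "A\<^sup>T = A"
  shows "\<exists>es. char_poly A = (\<Prod>e\<leftarrow>es. [:- e, 1:])"
proof -
  let ?C = "map_mat complex_of_real A"
  have C: "?C \<in> carrier_mat n n" using A by simp
  obtain as where as: "char_poly ?C = (\<Prod>a\<leftarrow>as. [:- a, 1:])"
    using char_poly_factorized[OF C] by auto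
  have real: "complex_of_real (Re a) = a" if "a \<in> set as" for a
  proof -
    have "poly (char_poly ?C) a = 0"
      unfolding as poly_prod_list using that by (auto simp: prod_list_zero_iff)
    hence "eigenvalue ?C a" using eigenvalue_root_char_poly[OF C] by simp
    from symmetric_real_eigenvalue[OF A sym this] show ?thesis
      by (simp add: complex_eq_iff)
  qed
  interpret H: map_poly_inj_idom_hom complex_of_real ..
  have hom: "map_poly complex_of_real (\<Prod>e\<leftarrow>map Re as. [:- e, 1:]) = (\<Prod>a\<leftarrow>as. [:- a, 1:])"
    using real
  proof (induction as)
    case (Cons a as)
    have "map_poly complex_of_real ([:- Re a, 1:] * p)
        = [:- a, 1:] * map_poly complex_of_real p" for p
    proof -
      have "map_poly complex_of_real [:- Re a, 1:] = [:- a, 1:]"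
        using Cons.prems[of a] by (simp add: map_poly_pCons)
      thus ?thesis unfolding H.hom_mult by simp
    qed
    thus ?case using Cons by simp
  qed simp
  have "map_poly complex_of_real (char_poly A) = char_poly ?C"
    by (simp add: of_real_hom.char_poly_hom[OF A])
  hence "map_poly complex_of_real (char_poly A)
      = map_poly complex_of_real (\<Prod>e\<leftarrow>map Re as. [:- e, 1:])"
    using as hom by simp
  hence "char_poly A = (\<Prod>e\<leftarrow>map Re as. [:- e, 1:])"
    by (rule H.injectivity)
  thus ?thesis by blast
qed

lemma trace_mult_comm:
  fixes X Y :: "real mat"
  assumes "X \<in> carrier_mat n n" "Y \<in> carrier_mat n n"
  shows "(\<Sum>i<n. (X * Y) $$ (i,i)) = (\<Sum>i<n. (Y * X) $$ (i,i))"
proof -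
  have "(\<Sum>i<n. (X * Y) $$ (i,i)) = (\<Sum>i<n. \<Sum>j<n. X $$ (i,j) * Y $$ (j,i))"
    using assms by (intro sum.cong) (auto simp: scalar_prod_def atLeast0LessThan)
  also have "\<dots> = (\<Sum>j<n. \<Sum>i<n. Y $$ (j,i) * X $$ (i,j))"
    by (subst sum.swap) (simp add: mult.commute)
  also have "\<dots> = (\<Sum>i<n. (Y * X) $$ (i,i))"
    using assms by (intro sum.cong) (auto simp: scalar_prod_def atLeast0LessThan)
  finally show ?thesis .
qed

text \<open>A triangular form suffices in place of a diagonal one: its first two columns span an
  invariant plane. The diagonal follows the order of \<open>es\<close>, so any two eigenvalues,
  counted with multiplicity, can be put in front.\<close>

lemma schur_two_columns:
  fixes A :: "real mat"
  assumes A: "A \<in> carrier_mat n n" and n: "2 \<le> n"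
    and cp: "char_poly A = (\<Prod>e\<leftarrow>es. [:- e, 1:])"
  obtains p1 p2 c where "p1 \<in> carrier_vec n" "p2 \<in> carrier_vec n"
    "A *\<^sub>v p1 = es ! 0 \<cdot>\<^sub>v p1" "A *\<^sub>v p2 = es ! 1 \<cdot>\<^sub>v p2 + c \<cdot>\<^sub>v p1"
    "\<And>t. p2 \<noteq> t \<cdot>\<^sub>v p1" "p1 \<noteq> 0\<^sub>v n"
proof -
  obtain B P Q where "schur_decomposition A es = (B,P,Q)" by (metis prod_cases3)
  from schur_decomposition[OF A cp this]
  have sim: "similar_mat_wit A B P Q" and ut: "upper_triangular B" and dg: "diag_mat B = es"
    by auto
  note s = similar_mat_witD2[OF A sim]
  have BC: "B \<in> carrier_mat n n" and PC: "P \<in> carrier_mat n n" and QC: "Q \<in> carrier_mat n n"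
    using s by auto
  have AP: "A * P = P * B"
  proof -
    have "A * P = P * B * (Q * P)" using s(3) PC BC QC by (simp add: assoc_mult_mat[of _ n n _ n _ n])
    thus ?thesis using s(2) PC BC by simp
  qed
  have colA: "A *\<^sub>v col P j = P *\<^sub>v col B j" if "j < n" for j
    using arg_cong[OF AP, of "\<lambda>M. col M j"] col_mult2[OF A PC that] col_mult2[OF PC BC that]
    by simp
  have Pu: "P *\<^sub>v unit_vec n j = col P j" if "j < n" for j
    using PC that by (intro eq_vecI) (auto simp: scalar_prod_right_unit[of _ n])
  have Qu: "Q *\<^sub>v col P j = unit_vec n j" if "j < n" for j
    using col_mult2[OF QC PC that] s(2) that by simp
  have dgi: "B $$ (i,i) = es ! i" if "i < n" for i
    using dg that BC unfolding diag_mat_def by auto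
  have c0: "col B 0 = es ! 0 \<cdot>\<^sub>v unit_vec n 0"
    using ut BC n dgi[of 0] by (intro eq_vecI) (auto simp: upper_triangular_def)
  have c1: "col B 1 = es ! 1 \<cdot>\<^sub>v unit_vec n 1 + B $$ (0,1) \<cdot>\<^sub>v unit_vec n 0"
  proof (intro eq_vecI)
    fix i assume "i < dim_vec (es ! 1 \<cdot>\<^sub>v unit_vec n 1 + B $$ (0,1) \<cdot>\<^sub>v unit_vec n 0)"
    hence "i < n" by simp
    moreover have "B $$ (i,1) = 0" if "1 < i" using ut BC n that \<open>i < n\<close> unfolding upper_triangular_def by auto
    ultimately show "col B 1 $ i = (es ! 1 \<cdot>\<^sub>v unit_vec n 1 + B $$ (0,1) \<cdot>\<^sub>v unit_vec n 0) $ i"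
      using BC n dgi[of 1] by (cases "i = 0"; cases "i = 1") auto
  qed (use BC in auto)
  have carr: "col P 0 \<in> carrier_vec n" "col P 1 \<in> carrier_vec n" using PC by auto
  show ?thesis
  proof (rule that[OF carr])
    show "A *\<^sub>v col P 0 = es ! 0 \<cdot>\<^sub>v col P 0"
      using colA[of 0] n Pu[of 0] PC unfolding c0 by (simp add: mult_mat_vec)
    show "A *\<^sub>v col P 1 = es ! 1 \<cdot>\<^sub>v col P 1 + B $$ (0,1) \<cdot>\<^sub>v col P 0"
      using colA[of 1] n Pu[of 0] Pu[of 1] PC unfolding c1
      by (simp add: mult_mat_vec mult_add_distrib_mat_vec[OF PC])
    show "col P 1 \<noteq> t \<cdot>\<^sub>v col P 0" for t
    proof
      assume "col P 1 = t \<cdot>\<^sub>v col P 0"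
      hence "unit_vec n 1 = t \<cdot>\<^sub>v unit_vec n 0"
        using Qu[of 0] Qu[of 1] n mult_mat_vec[OF QC carr(1), of t] by simp
      hence "unit_vec n 1 $ 1 = (t \<cdot>\<^sub>v unit_vec n 0) $ 1" by simp
      thus False using n by simp
    qed
    show "col P 0 \<noteq> 0\<^sub>v n"
    proof
      assume "col P 0 = 0\<^sub>v n"
      moreover have "Q *\<^sub>v 0\<^sub>v n = 0\<^sub>v n" using QC by (intro eq_vecI) auto
      moreover have "Q *\<^sub>v col P 0 = unit_vec n 0" using Qu[of 0] n by simp
      ultimately have "unit_vec n 0 = (0\<^sub>v n :: real vec)" by metis
      from arg_cong[OF this, of "\<lambda>v. v $ 0"] show False using n by simp
    qed
  qed
qed

lemma real_scalar_prod_pos: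
  fixes v :: "real vec"
  assumes "v \<in> carrier_vec n" "v \<noteq> 0\<^sub>v n"
  shows "0 < v \<bullet> v"
  using conjugate_square_greater_0_vec[OF assms(1)] assms(2) by simp

text \<open>Two orthogonal eigenvectors with nonnegative eigenvalues span a plane on which the form
  is nonnegative, and a plane meets every hyperplane in a nonzero vector. Starting from a triangular
  form also covers a repeated eigenvalue.\<close>

lemma symmetric_nonneg_eigenvalues_at_most_one:
  fixes A :: "real mat"
  assumes A: "A \<in> carrier_mat n n" and sym: "A\<^sup>T = A" and w: "w \<in> carrier_vec n"
    and neg: "\<And>x. x \<in> carrier_vec n \<Longrightarrow> x \<noteq> 0\<^sub>v n \<Longrightarrow> w \<bullet> x = 0 \<Longrightarrow> x \<bullet> (A *\<^sub>v x) < 0"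
    and n: "2 \<le> n" and cp: "char_poly A = (\<Prod>e\<leftarrow>es. [:- e, 1:])"
    and e: "0 \<le> es ! 0" "0 \<le> es ! 1"
  shows False
proof -
  obtain p q c where p: "p \<in> carrier_vec n" and q: "q \<in> carrier_vec n"
    and Ap: "A *\<^sub>v p = es ! 0 \<cdot>\<^sub>v p" and Aq: "A *\<^sub>v q = es ! 1 \<cdot>\<^sub>v q + c \<cdot>\<^sub>v p"
    and ind: "\<And>t. q \<noteq> t \<cdot>\<^sub>v p" and p0: "p \<noteq> 0\<^sub>v n"
    using schur_two_columns[OF A n cp] by metis
  have pp: "0 < p \<bullet> p" by (rule real_scalar_prod_pos[OF p p0])
  define t where "t = (p \<bullet> q) / (p \<bullet> p)"
  define r where "r = q - t \<cdot>\<^sub>v p"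
  have r: "r \<in> carrier_vec n" unfolding r_def using p q by simp
  have r0: "r \<noteq> 0\<^sub>v n"
  proof
    assume z: "r = 0\<^sub>v n"
    have "q = t \<cdot>\<^sub>v p"
    proof (intro eq_vecI)
      fix i assume "i < dim_vec (t \<cdot>\<^sub>v p)"
      hence i: "i < n" using p by simp
      have "r $ i = 0" using z i by simp
      thus "q $ i = (t \<cdot>\<^sub>v p) $ i" using i p q unfolding r_def by simp
    qed (use p q in auto)
    thus False using ind by simp
  qed
  have rr: "0 < r \<bullet> r" by (rule real_scalar_prod_pos[OF r r0])
  have pr: "p \<bullet> r = 0"
    unfolding r_def t_def using p q pp by (simp add: scalar_prod_minus_distrib)
  define c' where "c' = c + es ! 1 * t - t * es ! 0"
  have Ar: "A *\<^sub>v r = es ! 1 \<cdot>\<^sub>v r + c' \<cdot>\<^sub>v p"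
  proof -
    have "A *\<^sub>v r = (es ! 1 \<cdot>\<^sub>v q + c \<cdot>\<^sub>v p) - t \<cdot>\<^sub>v (es ! 0 \<cdot>\<^sub>v p)"
      unfolding r_def using A p q
      by (simp add: mult_minus_distrib_mat_vec mult_mat_vec Ap Aq)
    also have "\<dots> = es ! 1 \<cdot>\<^sub>v r + c' \<cdot>\<^sub>v p"
      unfolding r_def c'_def using p q by (intro eq_vecI) (auto simp: algebra_simps)
    finally show ?thesis .
  qed
  \<comment> \<open>Symmetry removes the off-diagonal coefficient: the left side is a multiple of
    \<open>p \<bullet> r = 0\<close>, the right side is \<open>c' * (p \<bullet> p)\<close>.\<close>
  have "(A *\<^sub>v p) \<bullet> r = p \<bullet> (A *\<^sub>v r)"
    using transpose_vec_mult_scalar[OF A r p] sym by simp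
  hence "c' * (p \<bullet> p) = 0"
    unfolding Ap Ar using p r pr
    by (simp add: scalar_prod_add_distrib[of _ n])
  hence "c' = 0" using pp by simp
  hence Ar': "A *\<^sub>v r = es ! 1 \<cdot>\<^sub>v r"
    using Ar r p by (intro eq_vecI) auto
  \<comment> \<open>The combination of \<open>p\<close> and \<open>r\<close> orthogonal to
    \<open>w\<close>. The case \<open>w \<bullet> p = 0\<close> is separate because both
    coefficients of the general formula could vanish there.\<close>
  define u v where "u = (if w \<bullet> p = 0 then 1 else w \<bullet> r)" and "v = (if w \<bullet> p = 0 then 0 else - (w \<bullet> p))"
  define x where "x = u \<cdot>\<^sub>v p + v \<cdot>\<^sub>v r"
  have x: "x \<in> carrier_vec n" unfolding x_def using p r by simp
  have rp: "r \<bullet> p = 0" using pr comm_scalar_prod[OF r p] by simp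
  have form: "(u \<cdot>\<^sub>v p + v \<cdot>\<^sub>v r) \<bullet> (a \<cdot>\<^sub>v p + b \<cdot>\<^sub>v r) = u * a * (p \<bullet> p) + v * b * (r \<bullet> r)" for a b
    using p r pr rp by (simp add: scalar_prod_add_distrib[of _ n] add_scalar_prod_distrib[of _ n])
  have "x \<bullet> x = u\<^sup>2 * (p \<bullet> p) + v\<^sup>2 * (r \<bullet> r)"
    unfolding x_def form by (simp add: power2_eq_square)
  moreover have "u \<noteq> 0 \<or> v \<noteq> 0" unfolding u_def v_def by simp
  ultimately have "x \<bullet> x \<noteq> 0" using pp rr
    by (smt (verit) mult_pos_pos zero_less_power2 zero_le_power2 mult_nonneg_nonneg)
  hence x0: "x \<noteq> 0\<^sub>v n" by auto
  have wx: "w \<bullet> x = 0"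
    unfolding x_def u_def v_def using w p r by (simp add: scalar_prod_add_distrib[of _ n])
  have "A *\<^sub>v x = (u * es ! 0) \<cdot>\<^sub>v p + (v * es ! 1) \<cdot>\<^sub>v r"
    unfolding x_def using A p r
    by (simp add: mult_add_distrib_mat_vec[OF A] mult_mat_vec Ap Ar' smult_smult_assoc)
  hence "x \<bullet> (A *\<^sub>v x) = u * (u * es ! 0) * (p \<bullet> p) + v * (v * es ! 1) * (r \<bullet> r)"
    unfolding x_def using form by simp
  also have "\<dots> \<ge> 0" using e pp rr
    by (metis (no_types, lifting) add_nonneg_nonneg less_imp_le mult.assoc mult_nonneg_nonneg zero_le_square)
  finally show False using neg[OF x x0 wx] by simp
qed

text \<open>Definiteness on a hyperplane leaves at most one nonnegative eigenvalue, and a positive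
  trace forces a positive one. Hence exactly one is positive and all others are strictly
  negative.\<close>

lemma signature_lorentzI:
  fixes A :: "real mat"
  assumes A: "A \<in> carrier_mat n n" and sym: "A\<^sup>T = A" and w: "w \<in> carrier_vec n"
    and neg: "\<And>x. x \<in> carrier_vec n \<Longrightarrow> x \<noteq> 0\<^sub>v n \<Longrightarrow> w \<bullet> x = 0 \<Longrightarrow> x \<bullet> (A *\<^sub>v x) < 0"
    and tr: "0 < (\<Sum>i<n. A $$ (i,i))"
  shows "signature_lorentz n A"
proof -
  obtain es0 where es0: "char_poly A = (\<Prod>e\<leftarrow>es0. [:- e, 1:])"
    using symmetric_char_poly_splits[OF A sym] by blast
  \<comment> \<open>Reordered so that two nonnegative eigenvalues, if they existed, would be
    \<open>es ! 0\<close> and \<open>es ! 1\<close>.\<close>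
  define es where "es = filter (\<lambda>e. 0 \<le> e) es0 @ filter (\<lambda>e. \<not> 0 \<le> e) es0"
  have ms: "mset es = mset es0" unfolding es_def by (simp add: mset_filter)
  have cp: "char_poly A = (\<Prod>e\<leftarrow>es. [:- e, 1:])"
    unfolding es0 using ms by (metis mset_map prod_mset_prod_list)
  obtain B P Q where sc: "schur_decomposition A es = (B,P,Q)" by (metis prod_cases3)
  from schur_decomposition[OF A cp sc]
  have sim: "similar_mat_wit A B P Q" and dg: "diag_mat B = es" by auto
  note s = similar_mat_witD2[OF A sim]
  have BC: "B \<in> carrier_mat n n" and PC: "P \<in> carrier_mat n n" and QC: "Q \<in> carrier_mat n n"
    using s by auto
  have len: "length es = n" using dg BC unfolding diag_mat_def by auto
  have "(\<Sum>i<n. A $$ (i,i)) = (\<Sum>i<n. (Q * (P * B)) $$ (i,i))"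
    unfolding s(3) using trace_mult_comm[of "P * B" n Q] PC BC QC by simp
  also have "Q * (P * B) = B" using assoc_mult_mat[OF QC PC BC] s(2) BC by simp
  also have "(\<Sum>i<n. B $$ (i,i)) = sum_list es"
    unfolding dg[symmetric] diag_mat_def using BC by (simp add: sum_list_sum_nth atLeast0LessThan)
  finally have "0 < sum_list es" using tr by simp
  hence "\<exists>e\<in>set es. 0 < e"
    using sum_list_nonpos[of es] by (meson not_le)
  then obtain e where e: "e \<in> set es" "0 < e" by blast
  hence e': "e \<in> set (filter (\<lambda>e. 0 \<le> e) es0)" unfolding es_def by auto
  have "length (filter (\<lambda>e. 0 \<le> e) es0) < 2"
  proof (rule ccontr)
    assume "\<not> ?thesis"
    then obtain a l' where l': "filter (\<lambda>e. 0 \<le> e) es0 = a # l'" "l' \<noteq> []"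
      by (cases "filter (\<lambda>e. 0 \<le> e) es0") auto
    then obtain b l where l: "filter (\<lambda>e. 0 \<le> e) es0 = a # b # l"
      by (cases l') auto
    have "set (filter (\<lambda>e. 0 \<le> e) es0) \<subseteq> {0..}" by auto
    hence ab: "0 \<le> a" "0 \<le> b" unfolding l by auto
    have es01: "es ! 0 = a" "es ! 1 = b" and "2 \<le> length es" unfolding es_def l by auto
    hence n2: "2 \<le> n" using len by simp
    have pos: "0 \<le> es ! 0" "0 \<le> es ! 1" unfolding es01 using ab by auto
    show False
      by (rule symmetric_nonneg_eigenvalues_at_most_one[OF A sym w _ n2 cp pos]) (rule neg)
  qed
  moreover from e' have "filter (\<lambda>e. 0 \<le> e) es0 \<noteq> []" by (metis empty_iff list.set(1))
  ultimately have f: "filter (\<lambda>e. 0 \<le> e) es0 = [e]"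
    using e' by (cases "filter (\<lambda>e. 0 \<le> e) es0") (auto simp: less_Suc_eq)
  define l where "l = filter (\<lambda>e. \<not> 0 \<le> e) es0"
  have es: "es = e # l" unfolding es_def f l_def by simp
  have l: "x < 0" if "x \<in> set l" for x using that unfolding l_def by auto
  have f1: "filter (\<lambda>r. 0 < r) l = []" "filter (\<lambda>r. r < 0) l = l"
    using l by (auto simp: filter_empty_conv filter_id_conv dest: less_asym)
  show ?thesis
    unfolding signature_lorentz_def
  proof (intro exI[of _ "mset es"] conjI)
    show "char_poly A = (\<Prod>r\<in>#mset es. [:- r, 1:])"
      unfolding cp by (metis mset_map prod_mset_prod_list)
    show "size (filter_mset ((<) 0) (mset es)) = 1"
      using f1 e(2) unfolding es by (simp flip: mset_filter)
    show "size {#r \<in># mset es. r < 0#} = n - 1"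
      using f1 e(2) len unfolding es by (simp flip: mset_filter)
  qed
qed

section \<open>Polynomials as finitely supported functions\<close>

abbreviation (input) lkp where "lkp \<equiv> Poly_Mapping.lookup"
abbreviation (input) sng where "sng \<equiv> Poly_Mapping.single"
abbreviation (input) kys where "kys \<equiv> Poly_Mapping.keys"

lemma poly_mapping_as_sum:
  fixes p :: "'k \<Rightarrow>\<^sub>0 'b::comm_monoid_add"
  shows "p = (\<Sum>m\<in>kys p. sng m (lkp p m))"
proof (rule poly_mapping_eqI)
  fix k
  show "lkp p k = lkp (\<Sum>m\<in>kys p. sng m (lkp p m)) k"
  proof (cases "k \<in> kys p")
    case True
    hence "(\<Sum>m\<in>kys p. lkp (sng m (lkp p m)) k) = lkp (sng k (lkp p k)) k"
      by (subst sum.remove[OF _ True]) (auto simp: lookup_single when_def intro!: sum.neutral)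
    thus ?thesis by (simp add: lookup_sum)
  next
    case False
    hence "(\<Sum>m\<in>kys p. lkp (sng m (lkp p m)) k) = 0"
      by (intro sum.neutral) (auto simp: lookup_single when_def)
    thus ?thesis using False by (simp add: lookup_sum in_keys_iff)
  qed
qed

lemma poly_mapping_add_induct [case_names single add]:
  fixes p :: "'k \<Rightarrow>\<^sub>0 'b::comm_monoid_add"
  assumes "\<And>m c. P (sng m c)" "\<And>p q. P p \<Longrightarrow> P q \<Longrightarrow> P (p + q)"
  shows "P p"
proof -
  have "P (\<Sum>m\<in>K. sng m (lkp p m))" if "finite K" for K
    using that
  proof induction
    case empty
    show ?case using assms(1)[of undefined 0] by simp
  qed (use assms in auto)
  thus ?thesis using poly_mapping_as_sum[of p] by (metis finite_keys)
qed

lemma monomial_add_induct [case_names zero add]: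
  fixes m :: "'k \<Rightarrow>\<^sub>0 nat"
  assumes z: "P 0" and a: "\<And>m v. P m \<Longrightarrow> P (m + sng v 1)"
  shows "P m"
proof -
  have s: "P q \<Longrightarrow> P (q + sng v c)" for q v c
  proof (induction c)
    case (Suc c)
    have "q + sng v (Suc c) = (q + sng v c) + sng v 1"
      by (simp add: single_add[symmetric] add.assoc)
    thus ?case using a Suc by metis
  qed simp
  have "\<forall>q. P q \<longrightarrow> P (q + m)"
    by (induction m rule: poly_mapping_add_induct) (auto simp: s add.assoc[symmetric])
  thus ?thesis using z by force
qed

lemma lookup_times_single:
  fixes P :: "('v \<Rightarrow>\<^sub>0 nat) \<Rightarrow>\<^sub>0 'b::comm_semiring_1"
  shows "lkp (sng (sng v 1) c * P) m
      = (if v \<in> kys m then c * lkp P (m - sng v 1) else 0)"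
proof (induction P rule: poly_mapping_add_induct)
  case (single k d)
  have "sng v 1 + k = m \<longleftrightarrow> v \<in> kys m \<and> k = m - sng v 1"
  proof
    assume "v \<in> kys m \<and> k = m - sng v 1"
    thus "sng v 1 + k = m"
      by (intro poly_mapping_eqI)
        (auto simp: lookup_add lookup_minus lookup_single when_def in_keys_iff)
  qed (auto simp: in_keys_iff lookup_add)
  thus ?case by (auto simp: mult_single lookup_single when_def)
next
  case (add p q)
  thus ?case by (simp add: distrib_left lookup_add)
qed

section \<open>Exponent vectors as lists of variables, and multinomial coefficients\<close>

text \<open>Truncations are iterated along lists, so exponent vectors are represented by lists too;
  independence of the order passes through \<open>monomial_eq_iff\<close>.\<close>

definition monomial :: "'v list \<Rightarrow> ('v \<Rightarrow>\<^sub>0 nat)" where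
  "monomial xs = sum_list (map (\<lambda>x. sng x 1) xs)"

lemma monomial_simps [simp]:
  "monomial [] = 0" "monomial (x # xs) = sng x 1 + monomial xs"
  "monomial (xs @ ys) = monomial xs + monomial ys"
  by (simp_all add: monomial_def)

lemma lookup_monomial: "lkp (monomial xs) v = count (mset xs) v"
  by (induction xs) (auto simp: lookup_add lookup_single when_def)

lemma keys_monomial [simp]: "kys (monomial xs) = set xs"
  by (auto simp: in_keys_iff lookup_monomial)

lemma monomial_eq_iff: "monomial xs = monomial ys \<longleftrightarrow> mset xs = mset ys"
  by (auto simp: poly_mapping_eq_iff fun_eq_iff lookup_monomial multiset_eq_iff)

lemma monomial_exhaust:
  fixes m :: "'v \<Rightarrow>\<^sub>0 nat"
  obtains xs where "m = monomial xs"
proof -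
  have "\<exists>xs. m = monomial xs"
  proof (induction m rule: monomial_add_induct)
    case zero
    show ?case by (rule exI[of _ "[]"]) simp
  next
    case (add m v)
    then obtain xs where "m = monomial xs" by blast
    thus ?case by (intro exI[of _ "v # xs"]) (simp add: add.commute)
  qed
  thus ?thesis using that by blast
qed

lemma mdeg_monomial [simp]: "mdeg (monomial xs) = length xs"
proof -
  have "mdeg (monomial xs) = sum (count (mset xs)) (set_mset (mset xs))"
    unfolding mdeg_def by (simp add: lookup_monomial)
  thus ?thesis using size_multiset_overloaded_eq[of "mset xs"] by simp
qed

lemma mdeg_add: "mdeg (m + n) = mdeg m + mdeg n"
proof -
  obtain xs ys where m: "m = monomial xs" and n: "n = monomial ys"
    by (metis monomial_exhaust)
  have "m + n = monomial (xs @ ys)" unfolding m n by simp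
  hence "mdeg (m + n) = length (xs @ ys)" by (simp only: mdeg_monomial)
  thus ?thesis unfolding m n by simp
qed

lemma mdeg_single [simp]: "mdeg (sng v k) = k"
  by (cases "k = 0") (simp_all add: mdeg_def)

lemma mdeg_zero [simp]: "mdeg 0 = 0"
  by (simp add: mdeg_def)

lemma prod_list_pvar: "prod_list (map pvar xs) = (sng (monomial xs) 1 :: (_ \<Rightarrow>\<^sub>0 'b::comm_semiring_1))"
  by (induction xs) (simp_all add: pvar_def mult_single)

definition mon_prod :: "('v \<Rightarrow> 'b::comm_monoid_mult) \<Rightarrow> ('v \<Rightarrow>\<^sub>0 nat) \<Rightarrow> 'b" where
  "mon_prod f m = (\<Prod>v\<in>kys m. f v ^ lkp m v)"

lemma mon_prod_superset:
  assumes "finite K" "kys m \<subseteq> K"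
  shows "mon_prod f m = (\<Prod>v\<in>K. f v ^ lkp m v)"
  unfolding mon_prod_def using assms by (intro prod.mono_neutral_left) (auto simp: in_keys_iff)

lemma mon_prod_add: "mon_prod f (m + n) = mon_prod f m * mon_prod f n"
proof -
  let ?K = "kys m \<union> kys n"
  have "mon_prod f (m + n) = (\<Prod>v\<in>?K. f v ^ lkp (m + n) v)"
    by (intro mon_prod_superset) (auto simp: keys_add)
  also have "\<dots> = (\<Prod>v\<in>?K. f v ^ lkp m v) * (\<Prod>v\<in>?K. f v ^ lkp n v)"
    by (simp add: lookup_add power_add prod.distrib)
  finally show ?thesis using mon_prod_superset[of ?K m f] mon_prod_superset[of ?K n f] by simp
qed

lemma mon_prod_zero [simp]: "mon_prod f 0 = 1"
  by (simp add: mon_prod_def)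

lemma mon_prod_single [simp]: "mon_prod f (sng v 1) = f v"
  by (simp add: mon_prod_def)

lemma mon_prod_monomial: "mon_prod f (monomial xs) = prod_list (map f xs)"
  by (induction xs) (simp_all add: mon_prod_add del: One_nat_def)

definition mfact :: "('v \<Rightarrow>\<^sub>0 nat) \<Rightarrow> nat" where
  "mfact m = (\<Prod>v\<in>kys m. fact (lkp m v))"

lemma mfact_zero [simp]: "mfact 0 = 1"
  by (simp add: mfact_def)

lemma mfact_pos: "0 < mfact m"
  unfolding mfact_def by (intro prod_pos) simp

lemma mfact_add_single: "mfact (m + sng v 1) = (lkp m v + 1) * mfact m"
proof -
  let ?K = "insert v (kys m)"
  have sup: "mfact n = (\<Prod>u\<in>?K. fact (lkp n u))" if "kys n \<subseteq> ?K" for n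
    unfolding mfact_def using that by (intro prod.mono_neutral_left) (auto simp: in_keys_iff)
  have "kys (m + sng v 1) \<subseteq> ?K" using keys_add[of m "sng v 1"] by auto
  hence "mfact (m + sng v 1) = (\<Prod>u\<in>?K. fact (lkp (m + sng v 1) u))" by (rule sup)
  also have "\<dots> = fact (lkp m v + 1) * (\<Prod>u\<in>?K - {v}. fact (lkp (m + sng v 1) u))"
    by (subst prod.remove[of _ v]) (auto simp: lookup_add)
  also have "(\<Prod>u\<in>?K - {v}. fact (lkp (m + sng v 1) u)) = (\<Prod>u\<in>?K - {v}. fact (lkp m u) :: nat)"
    by (intro prod.cong) (auto simp: lookup_add lookup_single when_def)
  also have "fact (lkp m v + 1) * \<dots> = (lkp m v + 1) * (\<Prod>u\<in>?K. fact (lkp m u))"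
    by (subst (2) prod.remove[of _ v]) (auto simp: algebra_simps)
  also have "(\<Prod>u\<in>?K. fact (lkp m u)) = mfact m" by (rule sup[symmetric]) auto
  finally show ?thesis .
qed

lemma monomial_minus_single:
  fixes m :: "'v \<Rightarrow>\<^sub>0 nat"
  assumes "v \<in> kys m"
  shows "(m - sng v 1) + sng v 1 = m"
  using assms by (intro poly_mapping_eqI)
    (auto simp: lookup_add lookup_minus lookup_single when_def in_keys_iff)

lemma keys_add_single: "kys (m + sng v (1::nat)) = insert v (kys m)"
  by (auto simp: in_keys_iff lookup_add lookup_single when_def split: if_splits)

lemma multinomial_coefficients:
  fixes h :: "'v \<Rightarrow> 'b::comm_ring_1"
  assumes V: "finite V"
  shows "of_nat (mfact m) * lkp ((\<Sum>v\<in>V. sng (sng v 1) (h v)) ^ n) m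
      = (if kys m \<subseteq> V \<and> mdeg m = n then of_nat (fact n) * mon_prod h m else 0)"
proof (induction n arbitrary: m)
  case 0
  obtain xs where m: "m = monomial xs" by (rule monomial_exhaust)
  have "(0 = m) = (xs = [])"
    unfolding m using monomial_eq_iff[of "[]" xs] by auto
  thus ?case by (cases "xs = []") (auto simp: lookup_one when_def m)
next
  case (Suc n)
  let ?L = "\<Sum>v\<in>V. sng (sng v 1) (h v)"
  define c where "c = of_nat (mfact m) * lkp (?L ^ Suc n) m"
  have "c = (\<Sum>v\<in>V. of_nat (mfact m) * lkp (sng (sng v 1) (h v) * ?L ^ n) m)"
    unfolding c_def by (simp add: sum_distrib_right lookup_sum sum_distrib_left)
  also have "\<dots> = (\<Sum>v\<in>V. if v \<in> kys m then of_nat (lkp m v) * h v *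
      (if kys (m - sng v 1) \<subseteq> V \<and> mdeg (m - sng v 1) = n
       then of_nat (fact n) * mon_prod h (m - sng v 1) else 0) else 0)"
  proof (intro sum.cong refl)
    fix v assume "v \<in> V"
    show "of_nat (mfact m) * lkp (sng (sng v 1) (h v) * ?L ^ n) m =
      (if v \<in> kys m then of_nat (lkp m v) * h v *
      (if kys (m - sng v 1) \<subseteq> V \<and> mdeg (m - sng v 1) = n
       then of_nat (fact n) * mon_prod h (m - sng v 1) else 0) else 0)"
    proof (cases "v \<in> kys m")
      case True
      hence "mfact m = lkp m v * mfact (m - sng v 1)"
        using mfact_add_single[of "m - sng v 1" v] monomial_minus_single[OF True]
        by (simp add: lookup_minus in_keys_iff)
      thus ?thesis using True unfolding lookup_times_single Suc.IH[symmetric]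
        by (simp add: algebra_simps)
    next
      case False
      thus ?thesis unfolding lookup_times_single by simp
    qed
  qed
  also have "\<dots> = (\<Sum>v\<in>V. if kys m \<subseteq> V \<and> mdeg m = Suc n
      then of_nat (lkp m v) * (of_nat (fact n) * mon_prod h m) else 0)"
  proof (intro sum.cong refl)
    fix v assume v: "v \<in> V"
    show "(if v \<in> kys m then of_nat (lkp m v) * h v *
      (if kys (m - sng v 1) \<subseteq> V \<and> mdeg (m - sng v 1) = n
       then of_nat (fact n) * mon_prod h (m - sng v 1) else 0) else 0)
      = (if kys m \<subseteq> V \<and> mdeg m = Suc n
      then of_nat (lkp m v) * (of_nat (fact n) * mon_prod h m) else 0)"
    proof (cases "v \<in> kys m")
      case True
      define k where "k = m - sng v 1"
      have m: "m = k + sng v 1" unfolding k_def using monomial_minus_single[OF True] by simp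
      have "kys m = insert v (kys k)" unfolding m by (rule keys_add_single)
      hence 1: "kys m \<subseteq> V \<longleftrightarrow> kys k \<subseteq> V" using v by auto
      have 2: "mdeg m = Suc n \<longleftrightarrow> mdeg k = n" unfolding m by (simp add: mdeg_add)
      have 3: "mon_prod h m = mon_prod h k * h v" unfolding m by (simp add: mon_prod_add del: One_nat_def)
      show ?thesis using True 1 2 3 unfolding k_def[symmetric] by (simp add: algebra_simps)
    next
      case False
      hence "lkp m v = 0" by (simp add: in_keys_iff)
      thus ?thesis using False by simp
    qed
  qed
  also have "\<dots> = (if kys m \<subseteq> V \<and> mdeg m = Suc n then of_nat (fact (Suc n)) * mon_prod h m else 0)"
  proof (cases "kys m \<subseteq> V \<and> mdeg m = Suc n")
    case True
    have "(\<Sum>v\<in>V. lkp m v) = mdeg m"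
      unfolding mdeg_def using True V by (intro sum.mono_neutral_right) (auto simp: in_keys_iff)
    hence "(\<Sum>v\<in>V. of_nat (lkp m v) :: 'b) = of_nat (Suc n)"
      using True by (metis of_nat_sum)
    hence "(\<Sum>v\<in>V. of_nat (lkp m v) * (of_nat (fact n) * mon_prod h m))
        = of_nat (Suc n) * (of_nat (fact n) * mon_prod h m)"
      by (simp only: sum_distrib_right[symmetric])
    thus ?thesis using True by (simp add: algebra_simps)
  next
    case False
    thus ?thesis by (simp only: if_False sum.neutral_const)
  qed
  finally show ?case unfolding c_def .
qed

section \<open>Partial derivatives\<close>

lemma lookup_pderiv_var:
  "lkp (pderiv_var v p) m = of_nat (lkp m v + 1) * lkp p (m + sng v 1)"
proof -
  have "lkp (pderiv_var v p) m
      = (\<Sum>k\<in>kys p. if k = m + sng v 1 then of_nat (lkp k v) * lkp p k else 0)"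
    unfolding pderiv_var_def lookup_sum
  proof (intro sum.cong refl)
    fix k
    show "lkp (sng (k - sng v 1) (of_nat (lkp k v) * lkp p k)) m
        = (if k = m + sng v 1 then of_nat (lkp k v) * lkp p k else 0)"
    proof (cases "v \<in> kys k")
      case True
      hence "k - sng v 1 = m \<longleftrightarrow> k = m + sng v 1"
        using monomial_minus_single[OF True] by auto
      thus ?thesis by (auto simp: lookup_single when_def)
    next
      \<comment> \<open>Exponents are subtracted with truncation at 0, so here
        \<open>k - sng v 1\<close> is \<open>k\<close> itself; the factor \<open>lkp k v = 0\<close>
        removes the spurious term.\<close>
      case False
      hence "lkp k v = 0" by (simp add: in_keys_iff)
      thus ?thesis by auto
    qed
  qed
  also have "\<dots> = of_nat (lkp m v + 1) * lkp p (m + sng v 1)"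
    by (auto simp: sum.delta in_keys_iff lookup_add)
  finally show ?thesis .
qed

text \<open>Coefficients normalised by the multi-index factorial are merely shifted by
  differentiation. This is why Hessian entries of polynomials with coefficients
  \<open>d! / m!\<close> times a weight are essentially the weights.\<close>

lemma mfact_lookup_pderivs:
  "of_nat (mfact m) * lkp (foldr pderiv_var vs p) m
     = of_nat (mfact (m + monomial vs)) * lkp p (m + monomial vs)"
proof (induction vs arbitrary: m)
  case (Cons v vs)
  have "of_nat (mfact m) * lkp (foldr pderiv_var (v # vs) p) m
      = of_nat (mfact (m + sng v 1)) * lkp (foldr pderiv_var vs p) (m + sng v 1)"
    unfolding mfact_add_single by (simp add: lookup_pderiv_var algebra_simps)
  thus ?case unfolding Cons.IH by (simp add: add.assoc)
qed simp

section \<open>Linear functionals given on monomials, and substitution homomorphisms\<close>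

definition lin_ext :: "(('v \<Rightarrow>\<^sub>0 nat) \<Rightarrow> real) \<Rightarrow> 'v rpoly \<Rightarrow> real" where
  "lin_ext b p = (\<Sum>m\<in>kys p. lkp p m * b m)"

lemma lin_ext_superset:
  assumes "finite K" "kys p \<subseteq> K"
  shows "lin_ext b p = (\<Sum>m\<in>K. lkp p m * b m)"
  unfolding lin_ext_def using assms by (intro sum.mono_neutral_left) (auto simp: in_keys_iff)

lemma lin_ext_add: "lin_ext b (p + q) = lin_ext b p + lin_ext b q"
proof -
  let ?K = "kys p \<union> kys q"
  have "lin_ext b (p + q) = (\<Sum>m\<in>?K. lkp (p + q) m * b m)"
    by (intro lin_ext_superset) (auto simp: keys_add)
  thus ?thesis using lin_ext_superset[of ?K p b] lin_ext_superset[of ?K q b]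
    by (simp add: lookup_add distrib_right sum.distrib)
qed

lemma lin_ext_zero [simp]: "lin_ext b 0 = 0"
  by (simp add: lin_ext_def)

lemma lin_ext_single [simp]: "lin_ext b (sng m c) = c * b m"
  by (simp add: lin_ext_def)

lemma lin_ext_scale: "lin_ext b (sng 0 c * p) = c * lin_ext b p"
  by (induction p rule: poly_mapping_add_induct)
    (simp_all add: mult_single distrib_left lin_ext_add)

lemma lin_ext_sum: "lin_ext b (\<Sum>i\<in>I. p i) = (\<Sum>i\<in>I. lin_ext b (p i))"
  by (induction I rule: infinite_finite_induct) (simp_all add: lin_ext_add)

lemma lin_ext_uminus: "lin_ext b (- p) = - lin_ext b p"
  using lin_ext_add[of b p "- p"] by simp

lemma lin_ext_diff: "lin_ext b (p - q) = lin_ext b p - lin_ext b q"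
  using lin_ext_add[of b p "- q"] by (simp add: lin_ext_uminus)

definition poly_subst :: "('v \<Rightarrow> 'w rpoly) \<Rightarrow> 'v rpoly \<Rightarrow> 'w rpoly" where
  "poly_subst f p = (\<Sum>m\<in>kys p. sng 0 (lkp p m) * mon_prod f m)"

lemma poly_subst_superset:
  assumes "finite K" "kys p \<subseteq> K"
  shows "poly_subst f p = (\<Sum>m\<in>K. sng 0 (lkp p m) * mon_prod f m)"
  unfolding poly_subst_def using assms by (intro sum.mono_neutral_left) (auto simp: in_keys_iff)

lemma poly_subst_add: "poly_subst f (p + q) = poly_subst f p + poly_subst f q"
proof -
  let ?K = "kys p \<union> kys q"
  have "poly_subst f (p + q) = (\<Sum>m\<in>?K. sng 0 (lkp (p + q) m) * mon_prod f m)"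
    by (intro poly_subst_superset) (auto simp: keys_add)
  thus ?thesis using poly_subst_superset[of ?K p f] poly_subst_superset[of ?K q f]
    by (simp add: lookup_add single_add distrib_right sum.distrib)
qed

lemma poly_subst_zero [simp]: "poly_subst f 0 = 0"
  by (simp add: poly_subst_def)

lemma poly_subst_single: "poly_subst f (sng m c) = sng 0 c * mon_prod f m"
  by (cases "c = 0") (simp_all add: poly_subst_def)

lemma poly_subst_one [simp]: "poly_subst f 1 = 1"
  using poly_subst_single[of f 0 1] by simp

lemma poly_subst_pvar [simp]: "poly_subst f (pvar v) = f v"
  unfolding pvar_def poly_subst_single by (simp del: One_nat_def)

lemma poly_subst_mult:
  fixes f :: "'v \<Rightarrow> 'w rpoly"
  shows "poly_subst f (p * q) = poly_subst f p * poly_subst f q"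
proof (induction p rule: poly_mapping_add_induct)
  case (single m c)
  show ?case
  proof (induction q rule: poly_mapping_add_induct)
    case (single n d)
    have cd: "sng 0 (c * d) = (sng 0 c * sng 0 d :: 'w rpoly)" by (simp add: mult_single)
    show ?case unfolding mult_single[of m c n d] poly_subst_single cd mon_prod_add by (simp only: ac_simps)
  qed (simp add: distrib_left poly_subst_add)
qed (simp add: distrib_right poly_subst_add)

lemma poly_subst_scale: "poly_subst f (sng 0 c * p) = sng 0 c * poly_subst f p"
  by (simp add: poly_subst_mult poly_subst_single)

lemma poly_subst_sum: "poly_subst f (\<Sum>i\<in>I. p i) = (\<Sum>i\<in>I. poly_subst f (p i))"
  by (induction I rule: infinite_finite_induct) (simp_all add: poly_subst_add)

lemma poly_subst_diff: "poly_subst f (p - q) = poly_subst f p - poly_subst f q"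
  using poly_subst_add[of f "p - q" q] by simp

lemma poly_subst_prod_list: "poly_subst f (prod_list ps) = prod_list (map (poly_subst f) ps)"
  by (induction ps) (simp_all add: poly_subst_mult)

section \<open>Variables and degrees\<close>

lemma vars_in_add: "vars_in V p \<Longrightarrow> vars_in V q \<Longrightarrow> vars_in V (p + q)"
  unfolding vars_in_def using keys_add[of p q] by blast

lemma homog_add: "homog n p \<Longrightarrow> homog n q \<Longrightarrow> homog n (p + q)"
  unfolding homog_def using keys_add[of p q] by blast

lemma vars_in_mult:
  fixes p q :: "'v rpoly"
  assumes "vars_in V p" "vars_in V q"
  shows "vars_in V (p * q)"
  unfolding vars_in_def
proof
  fix m assume "m \<in> kys (p * q)"
  then obtain a b where "m = a + b" "a \<in> kys p" "b \<in> kys q" using keys_mult[of p q] by blast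
  thus "kys m \<subseteq> V" using assms keys_add[of a b] unfolding vars_in_def by blast
qed

lemma homog_mult:
  fixes p q :: "'v rpoly"
  assumes "homog k p" "homog n q"
  shows "homog (k + n) (p * q)"
  unfolding homog_def
proof
  fix m assume "m \<in> kys (p * q)"
  then obtain a b where "m = a + b" "a \<in> kys p" "b \<in> kys q" using keys_mult[of p q] by blast
  thus "mdeg m = k + n" using assms unfolding homog_def by (simp add: mdeg_add)
qed

lemma vars_in_zero [simp]: "vars_in V 0" and homog_zero [simp]: "homog n 0"
  by (simp_all add: vars_in_def homog_def)

lemma vars_in_single: "kys m \<subseteq> V \<Longrightarrow> vars_in V (sng m c)"
  and homog_single: "mdeg m = n \<Longrightarrow> homog n (sng m c)"
  by (simp_all add: vars_in_def homog_def)

section \<open>Rank functions and principal truncation\<close>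

text \<open>Looplessness is the positivity clause. The class is closed under \<open>ptrunc\<close>,
  and closures behave in it as they do in a matroid.\<close>

definition rank_fun :: "'a set \<Rightarrow> ('a set \<Rightarrow> nat) \<Rightarrow> bool" where
  "rank_fun E r \<longleftrightarrow> (\<forall>S T. S \<subseteq> T \<longrightarrow> r S \<le> r T)
     \<and> (\<forall>S T. r (S \<union> T) + r (S \<inter> T) \<le> r S + r T)
     \<and> (\<forall>S. S \<subseteq> E \<and> S \<noteq> {} \<longrightarrow> 1 \<le> r S)"

lemma rank_fun_mono: "rank_fun E r \<Longrightarrow> S \<subseteq> T \<Longrightarrow> r S \<le> r T"
  and rank_fun_submod: "rank_fun E r \<Longrightarrow> r (S \<union> T) + r (S \<inter> T) \<le> r S + r T"
  and rank_fun_pos: "rank_fun E r \<Longrightarrow> S \<subseteq> E \<Longrightarrow> S \<noteq> {} \<Longrightarrow> 1 \<le> r S"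
  unfolding rank_fun_def by blast+

lemma rank_fun_submod':
  assumes "rank_fun E r" "K \<subseteq> S" "K \<subseteq> T" "U \<subseteq> S \<union> T"
  shows "r U + r K \<le> r S + r T"
proof -
  have "r U \<le> r (S \<union> T)" "r K \<le> r (S \<inter> T)"
    using assms by (auto intro!: rank_fun_mono[OF assms(1)])
  thus ?thesis using rank_fun_submod[OF assms(1), of S T] by linarith
qed

lemma rank_fun_Un_eq:
  assumes "rank_fun E r" "r (S \<union> T) = r S" "S \<subseteq> U"
  shows "r (U \<union> T) = r U"
proof -
  have "r (U \<union> T) + r S \<le> r U + r (S \<union> T)"
    using assms by (intro rank_fun_submod'[OF assms(1)]) auto
  moreover have "r U \<le> r (U \<union> T)" by (rule rank_fun_mono[OF assms(1)]) auto
  ultimately show ?thesis using assms(2) by linarith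
qed

lemma rank_fun_Un_eqI:
  assumes r: "rank_fun E r" and fin: "finite T" and "\<And>e. e \<in> T \<Longrightarrow> r (insert e S) = r S"
  shows "r (S \<union> T) = r S"
  using fin assms(3)
proof (induction T)
  case (insert e T)
  have "r ((S \<union> T) \<union> {e}) = r (S \<union> T)"
    by (rule rank_fun_Un_eq[OF r, of S]) (use insert.prems[of e] in auto)
  thus ?case using insert by (simp add: Un_insert_right)
qed simp

text \<open>Principal truncation along a set of rank at least two; sets of smaller rank act trivially,
  which makes all these operations commute.\<close>

definition ptrunc :: "'a set \<Rightarrow> ('a set \<Rightarrow> nat) \<Rightarrow> ('a set \<Rightarrow> nat)" where
  "ptrunc F r = (if 2 \<le> r F then (\<lambda>S. min (r S) (r (S \<union> F) - 1)) else r)"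

abbreviation ptruncs :: "'a set list \<Rightarrow> ('a set \<Rightarrow> nat) \<Rightarrow> ('a set \<Rightarrow> nat)" where
  "ptruncs \<equiv> fold ptrunc"

lemma ptrunc_le: "ptrunc F r S \<le> r S"
  by (simp add: ptrunc_def)

lemma ptrunc_apply: "2 \<le> r F \<Longrightarrow> ptrunc F r S = min (r S) (r (S \<union> F) - 1)"
  and ptrunc_trivial: "\<not> 2 \<le> r F \<Longrightarrow> ptrunc F r = r"
  by (simp_all add: ptrunc_def)

lemma rank_fun_ptrunc:
  assumes r: "rank_fun E r"
  shows "rank_fun E (ptrunc F r)"
proof (cases "2 \<le> r F")
  case F: True
  have ge: "2 \<le> r (S \<union> F)" for S
    using rank_fun_mono[OF r, of F "S \<union> F"] F by auto
  have mono: "ptrunc F r S \<le> ptrunc F r T" if "S \<subseteq> T" for S T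
  proof -
    have "r S \<le> r T" "r (S \<union> F) \<le> r (T \<union> F)"
      using that by (auto intro!: rank_fun_mono[OF r])
    thus ?thesis unfolding ptrunc_apply[of r, OF F] by linarith
  qed
  \<comment> \<open>The four inequalities correspond to the four choices of the terms that attain
    the two minima on the right-hand side.\<close>
  have sub: "ptrunc F r (S \<union> T) + ptrunc F r (S \<inter> T) \<le> ptrunc F r S + ptrunc F r T" for S T
  proof -
    have 1: "r (S \<union> T) + r (S \<inter> T) \<le> r S + r T"
      by (rule rank_fun_submod[OF r])
    have 2: "r (S \<union> T \<union> F) + r (S \<inter> T) \<le> r (S \<union> F) + r T"
      by (rule rank_fun_submod'[OF r]) auto
    have 3: "r (S \<union> T \<union> F) + r (S \<inter> T) \<le> r S + r (T \<union> F)"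
      by (rule rank_fun_submod'[OF r]) auto
    have 4: "r (S \<union> T \<union> F) + r (S \<inter> T \<union> F) \<le> r (S \<union> F) + r (T \<union> F)"
      by (rule rank_fun_submod'[OF r]) auto
    show ?thesis
      unfolding ptrunc_apply[of r, OF F] using 1 2 3 4 ge[of S] ge[of T] ge[of "S \<union> T"] ge[of "S \<inter> T"]
      by linarith
  qed
  \<comment> \<open>Rank at least two of \<open>F\<close> enters here:
    \<open>r (S \<union> F) - 1\<close> is still positive, so no loop is created.\<close>
  have pos: "1 \<le> ptrunc F r S" if "S \<subseteq> E" "S \<noteq> {}" for S
    unfolding ptrunc_apply[of r, OF F] using rank_fun_pos[OF r that] ge[of S] by linarith
  show ?thesis unfolding rank_fun_def using mono sub pos by blast
qed (simp add: ptrunc_trivial r)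

lemma rank_fun_ptruncs: "rank_fun E r \<Longrightarrow> rank_fun E (ptruncs Fs r)"
  by (induction Fs arbitrary: r) (simp_all add: rank_fun_ptrunc)

text \<open>A set of rank below two stays trivial after the other truncation. If the union has rank
  at least three, both sets stay nontrivial and the resulting minimum is symmetric. If the union has
  rank two, both sets span the same line, so the truncations agree and the second one has become
  trivial.\<close>

lemma ptrunc_commute:
  assumes r: "rank_fun E r"
  shows "ptrunc F (ptrunc G r) = ptrunc G (ptrunc F r)"
proof -
  have triv: "ptrunc A (ptrunc B r) = ptrunc B (ptrunc A r)" if "\<not> 2 \<le> r A" for A B
  proof -
    have "\<not> 2 \<le> ptrunc B r A" using that ptrunc_le[of B r A] by linarith
    thus ?thesis using that by (simp add: ptrunc_trivial)
  qed
  show ?thesis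
  proof (cases "2 \<le> r F \<and> 2 \<le> r G")
    case True
    hence F: "2 \<le> r F" and G: "2 \<le> r G" by auto
    show ?thesis
    proof (cases "3 \<le> r (F \<union> G)")
      case 3: True
      have "2 \<le> ptrunc F r G" "2 \<le> ptrunc G r F"
        using F G 3 by (simp_all add: ptrunc_apply Un_commute)
      thus ?thesis
        using F G by (auto simp: ptrunc_apply fun_eq_iff Un_ac min_diff[symmetric] ac_simps)
    next
      case False
      have "r F \<le> r (F \<union> G)" "r G \<le> r (F \<union> G)" by (auto intro!: rank_fun_mono[OF r])
      hence eq: "r (F \<union> G) = r F" "r (G \<union> F) = r G" using F G False by (auto simp: Un_commute)
      have "r (S \<union> F) = r (S \<union> G)" for S
      proof -
        have "r ((S \<union> F) \<union> G) = r (S \<union> F)" by (rule rank_fun_Un_eq[OF r eq(1)]) auto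
        moreover have "r ((S \<union> G) \<union> F) = r (S \<union> G)" by (rule rank_fun_Un_eq[OF r eq(2)]) auto
        ultimately show ?thesis by (simp add: Un_ac)
      qed
      hence "ptrunc F r = ptrunc G r" using F G by (auto simp: ptrunc_apply fun_eq_iff)
      moreover have "\<not> 2 \<le> ptrunc F r G" "\<not> 2 \<le> ptrunc G r F"
        using F G False by (simp_all add: ptrunc_apply Un_commute)
      ultimately show ?thesis by (simp add: ptrunc_trivial)
    qed
  qed (use triv in metis)
qed

lemma ptruncs_permute:
  assumes "rank_fun E r" "mset Fs = mset Gs"
  shows "ptruncs Fs r = ptruncs Gs r"
  by (rule fold_permuted_eq[where P = "rank_fun E"])
    (use assms in \<open>auto intro: rank_fun_ptrunc ptrunc_commute\<close>)

lemma ptrunc_Un_eq: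
  assumes r: "rank_fun E r" and eq: "r (S \<union> T) = r S"
  shows "ptrunc F r (S \<union> T) = ptrunc F r S"
proof -
  have "r (S \<union> F \<union> T) = r (S \<union> F)" by (rule rank_fun_Un_eq[OF r eq]) auto
  thus ?thesis using eq by (simp add: ptrunc_def Un_ac)
qed

lemma ptruncs_Un_eq:
  "rank_fun E r \<Longrightarrow> r (S \<union> T) = r S \<Longrightarrow> ptruncs Fs r (S \<union> T) = ptruncs Fs r S"
  by (induction Fs arbitrary: r) (simp_all add: rank_fun_ptrunc ptrunc_Un_eq)

lemma ptrunc_ground:
  assumes "F \<subseteq> E"
  shows "ptrunc F r E = r E - (if 2 \<le> r F then 1 else 0)"
  using assms by (auto simp: ptrunc_def Un_absorb2 min_def)

lemma ptruncs_ground_ge: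
  "set Fs \<subseteq> Pow E \<Longrightarrow> r E - length Fs \<le> ptruncs Fs r E"
proof (induction Fs arbitrary: r)
  case (Cons F Fs)
  hence "ptrunc F r E - length Fs \<le> ptruncs (F # Fs) r E" by simp
  thus ?case using ptrunc_ground[of F E r] Cons.prems by (auto split: if_splits)
qed simp

text \<open>Two sets of rank two on a common line count only once, because the first truncation
  turns that line into a point.\<close>

lemma ptrunc_ptrunc_ground:
  assumes r: "rank_fun E r" and F: "F \<subseteq> E" and G: "G \<subseteq> E" and E: "3 \<le> r E"
  shows "ptrunc F (ptrunc G r) E = r E -
    (if 2 \<le> r F \<and> 2 \<le> r G \<and> 3 \<le> r (F \<union> G) then 2 else if 2 \<le> r F \<or> 2 \<le> r G then 1 else 0)"
  unfolding ptrunc_ground[OF F] ptrunc_ground[OF G]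
  by (auto simp: ptrunc_def)

section \<open>Points, lines and closures\<close>

definition rank2_flats :: "'a set \<Rightarrow> ('a set \<Rightarrow> nat) \<Rightarrow> 'a set set" where
  "rank2_flats E r = {L. L \<subseteq> E \<and> r L = 2 \<and> (\<forall>e\<in>E - L. 2 < r (insert e L))}"

definition rank1_flats :: "'a set \<Rightarrow> ('a set \<Rightarrow> nat) \<Rightarrow> 'a set set" where
  "rank1_flats E r = {P. P \<subseteq> E \<and> r P = 1 \<and> (\<forall>e\<in>E - P. 1 < r (insert e P))}"

lemma finite_rank2_flats: "finite E \<Longrightarrow> finite (rank2_flats E r)"
  by (rule finite_subset[of _ "Pow E"]) (auto simp: rank2_flats_def)

text \<open>The flat is the closure of \<open>S\<close>: an element that leaves the rank of
  \<open>S\<close> unchanged leaves the rank of every larger set unchanged, hence lies in every flat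
  containing \<open>S\<close>.\<close>

lemma unique_flat_of_rank:
  assumes r: "rank_fun E r" and E: "finite E" and S: "S \<subseteq> E"
  shows "\<exists>!L. L \<subseteq> E \<and> S \<subseteq> L \<and> r L = r S \<and> (\<forall>e\<in>E - L. r S < r (insert e L))"
proof
  let ?L = "S \<union> {e\<in>E. r (insert e S) = r S}"
  have rL: "r ?L = r S" by (rule rank_fun_Un_eqI[OF r]) (use E in auto)
  have "r S < r (insert e ?L)" if "e \<in> E - ?L" for e
  proof -
    have "r S \<le> r (insert e S)" "r (insert e S) \<le> r (insert e ?L)"
      by (auto intro!: rank_fun_mono[OF r])
    moreover have "r (insert e S) \<noteq> r S" using that by auto
    ultimately show ?thesis by linarith
  qed
  thus "?L \<subseteq> E \<and> S \<subseteq> ?L \<and> r ?L = r S \<and> (\<forall>e\<in>E - ?L. r S < r (insert e ?L))"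
    using rL S by blast
  fix L assume L: "L \<subseteq> E \<and> S \<subseteq> L \<and> r L = r S \<and> (\<forall>e\<in>E - L. r S < r (insert e L))"
  show "L = ?L"
  proof
    show "L \<subseteq> ?L"
    proof
      fix e assume e: "e \<in> L"
      have "r S \<le> r (insert e S)" "r (insert e S) \<le> r L"
        by (rule rank_fun_mono[OF r], use e L in blast)+
      hence "r (insert e S) = r S" using L by linarith
      thus "e \<in> ?L" using e L by auto
    qed
    show "?L \<subseteq> L"
    proof
      fix e assume e: "e \<in> ?L"
      hence eE: "e \<in> E" using S by auto
      have "r (S \<union> {e}) = r S" using e by (cases "e \<in> S") (auto simp: insert_absorb)
      hence "r (L \<union> {e}) = r L" by (rule rank_fun_Un_eq[OF r, of S]) (use L in auto)
      thus "e \<in> L" using L eE by force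
    qed
  qed
qed

lemma sum_unique:
  assumes "finite A" "\<exists>!x. x \<in> A \<and> P x"
  shows "(\<Sum>x\<in>A. of_bool (P x) :: real) = 1"
proof -
  obtain x where "x \<in> A" "P x" and u: "\<And>y. y \<in> A \<Longrightarrow> P y \<Longrightarrow> y = x" using assms(2) by blast
  hence "{y\<in>A. P y} = {x}" by blast
  thus ?thesis using assms(1) by (simp add: of_bool_def sum.If_cases Int_def)
qed

lemma unique_rank2_flat:
  assumes "rank_fun E r" "finite E" "S \<subseteq> E" "r S = 2"
  shows "\<exists>!L. L \<in> rank2_flats E r \<and> S \<subseteq> L"
  using unique_flat_of_rank[OF assms(1-3)] assms(4) unfolding rank2_flats_def by (simp add: conj_ac)

lemma unique_rank1_flat:
  assumes "rank_fun E r" "finite E" "S \<subseteq> E" "r S = 1"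
  shows "\<exists>!L. L \<in> rank1_flats E r \<and> S \<subseteq> L"
  using unique_flat_of_rank[OF assms(1-3)] assms(4) unfolding rank1_flats_def by (simp add: conj_ac)

text \<open>Each summand on the right is a function of \<open>F\<close> times a function of \<open>G\<close>, so the formula
  extends bilinearly from the \<open>h\<^sub>F\<close> to the \<open>x\<^sub>F\<close>.\<close>

lemma rank3_pairing:
  assumes r: "rank_fun E r" and E: "finite E" "r E = 3" and F: "F \<subseteq> E" and G: "G \<subseteq> E"
  shows "of_bool (ptrunc F (ptrunc G r) E = 1) = (of_bool (2 \<le> r F) * of_bool (2 \<le> r G)
    - (\<Sum>L\<in>rank2_flats E r. of_bool (2 \<le> r F \<and> F \<subseteq> L) * of_bool (2 \<le> r G \<and> G \<subseteq> L)) :: real)"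
proof (cases "2 \<le> r F \<and> 2 \<le> r G")
  case True
  have le: "r F \<le> r (F \<union> G)" by (rule rank_fun_mono[OF r]) auto
  have "(\<Sum>L\<in>rank2_flats E r. of_bool (2 \<le> r F \<and> F \<subseteq> L) * of_bool (2 \<le> r G \<and> G \<subseteq> L) :: real)
      = (\<Sum>L\<in>rank2_flats E r. of_bool (F \<union> G \<subseteq> L))"
    using True by (intro sum.cong) auto
  \<comment> \<open>A union of rank two lies on exactly one line, a union of larger rank on
    none.\<close>
  also have "\<dots> = of_bool (r (F \<union> G) = 2)"
  proof (cases "r (F \<union> G) = 2")
    case 2: True
    show ?thesis
      using sum_unique[OF finite_rank2_flats[OF E(1)] unique_rank2_flat[OF r E(1) _ 2]] F G 2 by simp
  next
    case False
    have "\<not> F \<union> G \<subseteq> L" if "L \<in> rank2_flats E r" for L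
      using that rank_fun_mono[OF r, of "F \<union> G" L] le True False unfolding rank2_flats_def by auto
    thus ?thesis using False by (simp add: sum.neutral)
  qed
  finally show ?thesis
    using True le E(2) ptrunc_ptrunc_ground[OF r F G] by (auto simp: of_bool_def)
next
  case False
  thus ?thesis using ptrunc_ptrunc_ground[OF r F G] E(2) by auto
qed

section \<open>The rank function of a matroid\<close>

context
  fixes E :: "'a set" and indep
  assumes M: "matroid E indep"
begin

lemma matroid_finite: "finite E"
  and indep_empty: "indep {}"
  and indep_subset_ground: "indep X \<Longrightarrow> X \<subseteq> E"
  and indep_subset: "indep Y \<Longrightarrow> X \<subseteq> Y \<Longrightarrow> indep X"
  and indep_augment: "indep X \<Longrightarrow> indep Y \<Longrightarrow> card X < card Y \<Longrightarrow> \<exists>y\<in>Y - X. indep (insert y X)"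
  using M unfolding matroid_def by blast+

lemma finite_indep_cards: "finite (card ` {Y. Y \<subseteq> X \<and> indep Y})"
proof -
  have "{Y. Y \<subseteq> X \<and> indep Y} \<subseteq> Pow E" using indep_subset_ground by blast
  thus ?thesis by (intro finite_imageI) (auto intro: finite_subset simp: matroid_finite)
qed

lemma card_le_mrank: "Y \<subseteq> X \<Longrightarrow> indep Y \<Longrightarrow> card Y \<le> mrank indep X"
  unfolding mrank_def by (intro Max_ge finite_indep_cards) auto

lemma mrank_attained: "\<exists>Y\<subseteq>X. indep Y \<and> card Y = mrank indep X"
proof -
  have "mrank indep X \<in> card ` {Y. Y \<subseteq> X \<and> indep Y}"
    unfolding mrank_def using indep_empty by (intro Max_in finite_indep_cards) auto
  thus ?thesis by auto
qed

lemma extend_to_basis: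
  assumes "indep I" "I \<subseteq> X"
  shows "\<exists>J. I \<subseteq> J \<and> J \<subseteq> X \<and> indep J \<and> card J = mrank indep X"
  using assms
proof (induction "mrank indep X - card I" arbitrary: I rule: less_induct)
  case less
  show ?case
  proof (cases "card I = mrank indep X")
    case False
    hence lt: "card I < mrank indep X" using card_le_mrank[OF less.prems(2,1)] by linarith
    obtain Y where Y: "Y \<subseteq> X" "indep Y" "card Y = mrank indep X" using mrank_attained by blast
    then obtain y where y: "y \<in> Y - I" "indep (insert y I)"
      using indep_augment[OF less.prems(1) Y(2)] lt by auto
    have "finite I" using indep_subset_ground[OF less.prems(1)] matroid_finite finite_subset by blast
    hence "card (insert y I) = Suc (card I)" using y by simp
    hence "\<exists>J. insert y I \<subseteq> J \<and> J \<subseteq> X \<and> indep J \<and> card J = mrank indep X"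
      using lt y Y less.prems by (intro less.hyps) auto
    thus ?thesis by blast
  qed (use less.prems in blast)
qed

lemma rank_fun_mrank:
  assumes "loopless E indep"
  shows "rank_fun E (mrank indep)"
  unfolding rank_fun_def
proof (intro conjI allI impI)
  fix S T :: "'a set"
  assume "S \<subseteq> T"
  thus "mrank indep S \<le> mrank indep T"
    using mrank_attained[of S] card_le_mrank by (metis order_trans)
next
  fix S T :: "'a set"
  obtain I where I: "I \<subseteq> S \<inter> T" "indep I" "card I = mrank indep (S \<inter> T)"
    using mrank_attained by blast
  \<comment> \<open>A basis of the union that extends a basis of the intersection: its traces on
    \<open>S\<close> and \<open>T\<close> are independent, cover it, and both contain
    \<open>I\<close>.\<close>
  obtain J where J: "I \<subseteq> J" "J \<subseteq> S \<union> T" "indep J" "card J = mrank indep (S \<union> T)"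
    using extend_to_basis[OF I(2), of "S \<union> T"] I(1) by auto
  have fin: "finite J" using indep_subset_ground[OF J(3)] matroid_finite finite_subset by blast
  have "card J + card I \<le> card ((J \<inter> S) \<union> (J \<inter> T)) + card ((J \<inter> S) \<inter> (J \<inter> T))"
    using fin I(1) J(1,2) by (intro add_mono card_mono) auto
  also have "\<dots> = card (J \<inter> S) + card (J \<inter> T)"
    using fin by (intro card_Un_Int[symmetric]) auto
  also have "\<dots> \<le> mrank indep S + mrank indep T"
    using indep_subset[OF J(3)] by (intro add_mono card_le_mrank) auto
  finally show "mrank indep (S \<union> T) + mrank indep (S \<inter> T) \<le> mrank indep S + mrank indep T"
    using I J by simp
next
  fix S assume "S \<subseteq> E \<and> S \<noteq> {}"
  then obtain e where "e \<in> S" "indep {e}" using assms unfolding loopless_def by blast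
  thus "1 \<le> mrank indep S" using card_le_mrank[of "{e}" S] by simp
qed

lemma mrank_singleton: "loopless E indep \<Longrightarrow> e \<in> E \<Longrightarrow> mrank indep {e} = 1"
proof -
  assume l: "loopless E indep" "e \<in> E"
  obtain Y where "Y \<subseteq> {e}" "card Y = mrank indep {e}" using mrank_attained by blast
  hence "mrank indep {e} \<le> 1" using card_mono[of "{e}" Y] by simp
  thus ?thesis using rank_fun_pos[OF rank_fun_mrank[OF l(1)], of "{e}"] l(2) by simp
qed

lemma mrank_empty [simp]: "mrank indep {} = 0"
  using mrank_attained[of "{}"] by auto

end

section \<open>Strictly Lorentzian approximations\<close>

text \<open>A sum of squares, one for each value of \<open>g\<close>: the indicator of
  \<open>g i = g j\<close> is a block matrix of ones.\<close>

lemma sum_classes_nonneg: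
  fixes z :: "'i \<Rightarrow> real"
  assumes "finite I"
  shows "0 \<le> (\<Sum>i\<in>I. \<Sum>j\<in>I. of_bool (g i = g j) * (z i * z j))"
proof -
  have "(\<Sum>i\<in>I. \<Sum>j\<in>I. of_bool (g i = g j) * (z i * z j))
      = (\<Sum>i\<in>I. \<Sum>j\<in>I. \<Sum>c\<in>g ` I. (of_bool (g i = c) * z i) * (of_bool (g j = c) * z j))"
  proof (intro sum.cong refl)
    fix i j assume i: "i \<in> I" and "j \<in> I"
    have "(\<Sum>c\<in>g ` I. (of_bool (g i = c) * z i) * (of_bool (g j = c) * z j))
        = (\<Sum>c\<in>g ` I. if c = g i then of_bool (g i = g j) * (z i * z j) else 0)"
      by (intro sum.cong) (auto simp: of_bool_def)
    thus "of_bool (g i = g j) * (z i * z j)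
        = (\<Sum>c\<in>g ` I. (of_bool (g i = c) * z i) * (of_bool (g j = c) * z j))"
      using i assms by simp
  qed
  also have "\<dots> = (\<Sum>c\<in>g ` I. \<Sum>i\<in>I. \<Sum>j\<in>I. (of_bool (g i = c) * z i) * (of_bool (g j = c) * z j))"
  proof -
    have "(\<Sum>i\<in>I. \<Sum>j\<in>I. \<Sum>c\<in>g ` I. (of_bool (g i = c) * z i) * (of_bool (g j = c) * z j))
        = (\<Sum>i\<in>I. \<Sum>c\<in>g ` I. \<Sum>j\<in>I. (of_bool (g i = c) * z i) * (of_bool (g j = c) * z j))"
      by (intro sum.cong refl sum.swap)
    also have "\<dots> = (\<Sum>c\<in>g ` I. \<Sum>i\<in>I. \<Sum>j\<in>I. (of_bool (g i = c) * z i) * (of_bool (g j = c) * z j))"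
      by (rule sum.swap)
    finally show ?thesis .
  qed
  also have "\<dots> = (\<Sum>c\<in>g ` I. (\<Sum>i\<in>I. of_bool (g i = c) * z i)\<^sup>2)"
    by (simp add: power2_eq_square sum_product)
  also have "0 \<le> \<dots>" by (intro sum_nonneg) simp
  finally show ?thesis .
qed

text \<open>Damping the diagonal by the factor \<open>q < 1\<close> turns a semidefinite form
  into a definite one on the hyperplane.\<close>

lemma damped_form_negative:
  fixes z w :: "'i \<Rightarrow> real"
  assumes fin: "finite I" and c: "0 \<le> c" and q: "q < 1"
    and A: "\<And>i j. i \<in> I \<Longrightarrow> j \<in> I \<Longrightarrow>
      A i j = w i * w j - c * of_bool (i \<in> P \<and> j \<in> P \<and> g i = g j)"
    and diag: "\<And>i. i \<in> I \<Longrightarrow> 0 < A i i"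
    and hyp: "(\<Sum>i\<in>I. w i * z i) = 0" and nz: "\<exists>i\<in>I. z i \<noteq> 0"
  shows "(\<Sum>i\<in>I. \<Sum>j\<in>I. z i * z j * A i j * (if i = j then q else 1)) < 0"
proof -
  let ?u = "\<lambda>i. of_bool (i \<in> P) * z i"
  let ?S = "\<Sum>i\<in>I. \<Sum>j\<in>I. of_bool (g i = g j) * (?u i * ?u j)"
  let ?D = "\<Sum>i\<in>I. A i i * (z i)\<^sup>2"
  have "(\<Sum>i\<in>I. \<Sum>j\<in>I. z i * z j * A i j * (if i = j then q else 1))
      = (\<Sum>i\<in>I. \<Sum>j\<in>I. (w i * z i) * (w j * z j) - c * (of_bool (g i = g j) * (?u i * ?u j))
          - (if i = j then (1 - q) * (A i i * (z i)\<^sup>2) else 0))"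
  proof (intro sum.cong refl)
    fix i j assume ij: "i \<in> I" "j \<in> I"
    have 1: "z i * z j * A i j = (w i * z i) * (w j * z j) - c * (of_bool (g i = g j) * (?u i * ?u j))"
      unfolding A[OF ij] by (auto simp: of_bool_def algebra_simps)
    have 2: "z i * z j * A i j * (if i = j then q else 1)
        = z i * z j * A i j - (if i = j then (1 - q) * (A i i * (z i)\<^sup>2) else 0)"
      by (simp add: power2_eq_square algebra_simps)
    show "z i * z j * A i j * (if i = j then q else 1)
        = (w i * z i) * (w j * z j) - c * (of_bool (g i = g j) * (?u i * ?u j))
          - (if i = j then (1 - q) * (A i i * (z i)\<^sup>2) else 0)"
      unfolding 2 unfolding 1 ..
  qed
  also have "\<dots> = (\<Sum>i\<in>I. \<Sum>j\<in>I. (w i * z i) * (w j * z j)) - c * ?S - (1 - q) * ?D"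
    using fin by (simp add: sum_subtractf sum_distrib_left
        del: sum_mult_of_bool_eq sum_of_bool_mult_eq)
  also have "(\<Sum>i\<in>I. \<Sum>j\<in>I. (w i * z i) * (w j * z j)) = (\<Sum>i\<in>I. w i * z i)\<^sup>2"
    by (simp add: power2_eq_square sum_product)
  also have "\<dots> - c * ?S - (1 - q) * ?D < 0"
  proof -
    have "0 \<le> c * ?S" using sum_classes_nonneg[OF fin] c by (intro mult_nonneg_nonneg) auto
    \<comment> \<open>The only strict contribution. On the hyperplane the rank one square is zero
      and the class form can only lower the value.\<close>
    moreover have "0 < ?D"
    proof -
      obtain i where "i \<in> I" "z i \<noteq> 0" using nz by blast
      thus ?thesis using diag fin by (intro sum_pos2[of I i]) (auto simp: less_imp_le)
    qed
    hence "0 < (1 - q) * ?D" using q by (intro mult_pos_pos) auto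
    ultimately show ?thesis using hyp by simp
  qed
  finally show ?thesis .
qed

section \<open>The approximating polynomials and their Hessians\<close>

lemma finite_deg_monomials:
  assumes "finite V"
  shows "finite (deg_monomials V d)"
proof -
  have "deg_monomials V d \<subseteq> monomial ` {xs. set xs \<subseteq> V \<and> length xs = d}"
  proof
    fix m assume m: "m \<in> deg_monomials V d"
    obtain xs where "m = monomial xs" by (rule monomial_exhaust)
    thus "m \<in> monomial ` {xs. set xs \<subseteq> V \<and> length xs = d}"
      using m by (auto simp: deg_monomials_def)
  qed
  thus ?thesis using finite_lists_length_eq[OF assms] finite_surj by blast
qed

lemma monomial_in_deg_monomials:
  "monomial xs \<in> deg_monomials V d \<longleftrightarrow> set xs \<subseteq> V \<and> length xs = d"
  by (simp add: deg_monomials_def)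

text \<open>This is \<rho>(m). The choice of the list is immaterial because truncations
  commute.\<close>

definition ptruncs_rank :: "'a set \<Rightarrow> ('a set \<Rightarrow> nat) \<Rightarrow> ('a set \<Rightarrow>\<^sub>0 nat) \<Rightarrow> nat" where
  "ptruncs_rank E r m = ptruncs (SOME Fs. m = monomial Fs) r E"

lemma ptruncs_rank_monomial:
  assumes "rank_fun E r"
  shows "ptruncs_rank E r (monomial Fs) = ptruncs Fs r E"
proof -
  have "monomial Fs = monomial (SOME Gs. monomial Fs = monomial Gs)" by (rule someI) simp
  thus ?thesis unfolding ptruncs_rank_def
    using ptruncs_permute[OF assms] by (metis monomial_eq_iff)
qed

definition sq_sum :: "'v set \<Rightarrow> ('v \<Rightarrow>\<^sub>0 nat) \<Rightarrow> nat" where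
  "sq_sum V m = (\<Sum>v\<in>V. (lkp m v)\<^sup>2)"

lemma sq_sum_add_single:
  assumes "finite V" "v \<in> V"
  shows "sq_sum V (m + sng v 1) = sq_sum V m + 2 * lkp m v + 1"
proof -
  have "sq_sum V (m + sng v 1) = (\<Sum>u\<in>V. (lkp m u)\<^sup>2 + (if u = v then 2 * lkp m v + 1 else 0))"
    unfolding sq_sum_def
    by (intro sum.cong) (auto simp: lookup_add lookup_single when_def power2_eq_square)
  thus ?thesis using assms by (simp add: sum.distrib sq_sum_def)
qed

definition approx_poly ::
  "'a set \<Rightarrow> ('a set \<Rightarrow> nat) \<Rightarrow> 'a set set \<Rightarrow> nat \<Rightarrow> real \<Rightarrow> real \<Rightarrow> 'a set rpoly" where
  "approx_poly E r V d \<epsilon> q = (\<Sum>m\<in>deg_monomials V d.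
     sng m (fact d / mfact m * \<epsilon> ^ (ptruncs_rank E r m - 1) * q ^ sq_sum V m))"

lemma lookup_approx_poly:
  assumes "finite V"
  shows "lkp (approx_poly E r V d \<epsilon> q) m = (if m \<in> deg_monomials V d
    then fact d / mfact m * \<epsilon> ^ (ptruncs_rank E r m - 1) * q ^ sq_sum V m else 0)"
  unfolding approx_poly_def lookup_sum
  using finite_deg_monomials[OF assms, of d]
  by (simp add: lookup_single when_def sum.delta)

text \<open>The factorials cancel by \<open>mfact_lookup_pderivs\<close>. In the exponent of
  \<open>q\<close> only the last summand couples \<open>u\<close> with \<open>v\<close>; the others
  split into a constant, a term in \<open>u\<close> and a term in \<open>v\<close>.\<close>

lemma hessian_approx_poly:
  assumes r: "rank_fun E r" and V: "finite V" and uv: "u \<in> V" "v \<in> V"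
    and Fs: "length Fs = d - 2" "set Fs \<subseteq> V" and d: "2 \<le> d"
  shows "lkp (pderiv_var u (pderiv_var v (foldr pderiv_var Fs (approx_poly E r V d \<epsilon> q)))) 0
    = fact d * \<epsilon> ^ (ptrunc u (ptrunc v (ptruncs Fs r)) E - 1)
      * q ^ (sq_sum V (monomial Fs) + 2 * lkp (monomial Fs) u + 2 * lkp (monomial Fs) v
          + 2 + (if u = v then 2 else 0))"
proof -
  let ?f = "approx_poly E r V d \<epsilon> q" and ?m = "monomial (u # v # Fs)"
  have "lkp (foldr pderiv_var (u # v # Fs) ?f) 0 = of_nat (mfact ?m) * lkp ?f ?m"
    using mfact_lookup_pderivs[of 0 "u # v # Fs" ?f] by simp
  also have "?m \<in> deg_monomials V d"
    using uv Fs d unfolding monomial_in_deg_monomials by simp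
  hence "of_nat (mfact ?m) * lkp ?f ?m
      = fact d * \<epsilon> ^ (ptruncs_rank E r ?m - 1) * q ^ sq_sum V ?m"
    unfolding lookup_approx_poly[OF V] using mfact_pos[of ?m] by simp
  also have "ptruncs_rank E r ?m = ptrunc u (ptrunc v (ptruncs Fs r)) E"
  proof -
    have "ptruncs (u # v # Fs) r = ptruncs (Fs @ [v, u]) r"
      by (rule ptruncs_permute[OF r]) simp
    thus ?thesis unfolding ptruncs_rank_monomial[OF r] by simp
  qed
  also have "sq_sum V ?m = sq_sum V (monomial Fs) + 2 * lkp (monomial Fs) u + 2 * lkp (monomial Fs) v
          + 2 + (if u = v then 2 else 0)"
  proof -
    have m: "?m = (monomial Fs + sng v 1) + sng u 1" by (simp add: add_ac)
    show ?thesis unfolding m sq_sum_add_single[OF V uv(1)] sq_sum_add_single[OF V uv(2)]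
      by (simp add: lookup_add lookup_single when_def)
  qed
  finally show ?thesis by simp
qed

text \<open>Equality of the sets of all \<open>t\<close> spanning rank at most two together with \<open>u\<close>, respectively \<open>v\<close>,
  expresses that \<open>u\<close> and \<open>v\<close> are parallel, in a form that is visibly an equivalence relation.\<close>

lemma truncation_weights:
  fixes \<epsilon> :: real
  assumes N: "rank_fun E N" and R: "3 \<le> N E" and u: "u \<subseteq> E" and v: "v \<subseteq> E"
  defines "w \<equiv> \<lambda>F. if 2 \<le> N F then 1 else \<epsilon>"
  shows "\<epsilon> ^ (ptrunc u (ptrunc v N) E - 1) = \<epsilon> ^ (N E - 3) * (w u * w v
    - (1 - \<epsilon>) * of_bool (N u = 2 \<and> N v = 2 \<and> {t. N (u \<union> t) \<le> 2} = {t. N (v \<union> t) \<le> 2}))"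
proof -
  have le: "N u \<le> N (u \<union> v)" "N v \<le> N (u \<union> v)" by (auto intro!: rank_fun_mono[OF N])
  \<comment> \<open>Submodularity over the common part \<open>a\<close> of rank two makes
    parallelism transitive.\<close>
  have trans: "N (b \<union> t) \<le> 2" if "N a = 2" "N (a \<union> b) \<le> 2" "N (a \<union> t) \<le> 2" for a b t
  proof -
    have "N (b \<union> t) + N a \<le> N (a \<union> b) + N (a \<union> t)" by (rule rank_fun_submod'[OF N]) auto
    thus ?thesis using that by linarith
  qed
  have par: "N u = 2 \<and> N v = 2 \<and> {t. N (u \<union> t) \<le> 2} = {t. N (v \<union> t) \<le> 2}
      \<longleftrightarrow> 2 \<le> N u \<and> 2 \<le> N v \<and> \<not> 3 \<le> N (u \<union> v)"
  proof
    assume *: "N u = 2 \<and> N v = 2 \<and> {t. N (u \<union> t) \<le> 2} = {t. N (v \<union> t) \<le> 2}"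
    hence "v \<in> {t. N (v \<union> t) \<le> 2}" by simp
    hence "N (u \<union> v) \<le> 2" using * by blast
    thus "2 \<le> N u \<and> 2 \<le> N v \<and> \<not> 3 \<le> N (u \<union> v)" using * by simp
  next
    assume *: "2 \<le> N u \<and> 2 \<le> N v \<and> \<not> 3 \<le> N (u \<union> v)"
    hence uv: "N u = 2" "N v = 2" "N (u \<union> v) \<le> 2" "N (v \<union> u) \<le> 2" using le by (auto simp: Un_commute)
    show "N u = 2 \<and> N v = 2 \<and> {t. N (u \<union> t) \<le> 2} = {t. N (v \<union> t) \<le> 2}"
      using uv trans by blast
  qed
  \<comment> \<open>Here \<open>c\<close> is the rank lost in the two truncations;
    \<open>N E - 3\<close> is the exponent left when both of them count.\<close>
  have p: "\<epsilon> ^ (N E - c - 1) = \<epsilon> ^ (N E - 3) * \<epsilon> ^ (2 - c)" if "c \<le> 2" for c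
  proof -
    have "N E - c - 1 = (N E - 3) + (2 - c)" using that R by linarith
    thus ?thesis by (simp only: power_add)
  qed
  \<comment> \<open>For parallel sets both weights are 1 although only one truncation counts, so the
    entry is \<open>\<epsilon>\<close> instead of 1; this is the correction by
    \<open>1 - \<epsilon>\<close>.\<close>
  show ?thesis
    unfolding ptrunc_ptrunc_ground[OF N u v R] par
    using p[of 2] p[of 1] p[of 0] by (auto simp: w_def power2_eq_square)
qed

lemma strictly_lorentzian_approx_poly:
  assumes r: "rank_fun E r" and V: "finite V" "V \<subseteq> Pow E" and rE: "r E = d + 1"
    and ne: "2 \<le> d \<Longrightarrow> V \<noteq> {}" and \<epsilon>: "0 < \<epsilon>" "\<epsilon> \<le> 1" and q: "0 < q" "q < 1"
  shows "strictly_lorentzian V d (approx_poly E r V d \<epsilon> q)"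
  unfolding strictly_lorentzian_def
proof (intro conjI ballI impI allI)
  let ?f = "approx_poly E r V d \<epsilon> q"
  show "kys ?f \<subseteq> deg_monomials V d"
    by (auto simp: in_keys_iff lookup_approx_poly[OF V(1)] split: if_splits)
  show "0 < lkp ?f m" if "m \<in> deg_monomials V d" for m
    using that \<epsilon> q mfact_pos[of m] by (simp add: lookup_approx_poly[OF V(1)])
  fix Fs assume d: "2 \<le> d" and Fs: "length Fs = d - 2 \<and> set Fs \<subseteq> V"
  define vs where "vs = var_enum V"
  have "\<exists>vs. distinct vs \<and> set vs = V" using finite_distinct_list[OF V(1)] by blast
  hence vs: "distinct vs" "set vs = V"
    unfolding vs_def var_enum_def using someI_ex[of "\<lambda>vs. distinct vs \<and> set vs = V"] by auto
  define n where "n = length vs"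
  have n: "card V = n" using vs distinct_card unfolding n_def by metis
  \<comment> \<open>A positive trace requires at least one variable.\<close>
  have n0: "0 < n" using n ne[OF d] V(1) by (metis card_gt_0_iff)
  have vsV: "vs ! i \<in> V" if "i < n" for i using that vs(2) n_def by auto
  have vsE: "vs ! i \<subseteq> E" if "i < n" for i using vsV[OF that] V(2) by auto
  have vs_inj: "vs ! i = vs ! j \<longleftrightarrow> i = j" if "i < n" "j < n" for i j
    using that vs(1) n_def by (simp add: nth_eq_iff_index_eq)
  define N where "N = ptruncs Fs r"
  have N: "rank_fun E N" unfolding N_def by (rule rank_fun_ptruncs[OF r])
  \<comment> \<open>The \<open>d - 2\<close> derivatives lower the rank \<open>d + 1\<close> by at
    most one each.\<close>
  have NE: "3 \<le> N E"
    using ptruncs_ground_ge[of Fs E r] Fs V(2) rE d unfolding N_def by auto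
  define m where "m = monomial Fs"
  define K where "K = fact d * \<epsilon> ^ (N E - 3) * q ^ (sq_sum V m + 2)"
  have K: "0 < K" unfolding K_def using \<epsilon> q by simp
  \<comment> \<open>The diagonal scaling that absorbs the part of the exponent of \<open>q\<close>
    depending on a single index.\<close>
  define y where "y i = q ^ (2 * lkp m (vs ! i))" for i
  have y: "0 < y i" for i unfolding y_def using q by simp
  define w where "w i = (if 2 \<le> N (vs ! i) then 1 else \<epsilon>)" for i
  define P where "P = {i. N (vs ! i) = 2}"
  define g where "g i = {t. N (vs ! i \<union> t) \<le> 2}" for i
  define A where "A i j = w i * w j - (1 - \<epsilon>) * of_bool (i \<in> P \<and> j \<in> P \<and> g i = g j)" for i j
  have A_eq: "\<epsilon> ^ (ptrunc (vs ! i) (ptrunc (vs ! j) N) E - 1) = \<epsilon> ^ (N E - 3) * A i j"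
    if "i < n" "j < n" for i j
    using truncation_weights[OF N NE vsE[OF that(1)] vsE[OF that(2)], of \<epsilon>]
    unfolding A_def w_def P_def g_def by simp
  \<comment> \<open>By \<open>A_eq\<close> the entry is a power of \<open>\<epsilon>\<close> up to a
    positive factor.\<close>
  have A_diag: "0 < A i i" if "i < n" for i
  proof -
    have "0 < \<epsilon> ^ (N E - 3) * A i i" unfolding A_eq[OF that that, symmetric] using \<epsilon> by simp
    thus ?thesis using \<epsilon> by (simp add: zero_less_mult_iff)
  qed
  have A_sym: "A i j = A j i" for i j
    unfolding A_def by (auto simp: of_bool_def)
  define H where "H = hessian V (foldr pderiv_var Fs ?f)"
  have H: "H \<in> carrier_mat n n" unfolding H_def hessian_def Let_def vs_def[symmetric] n_def by simp
  have H_entry: "H $$ (i, j) = K * (y i * y j * A i j * (if i = j then q\<^sup>2 else 1))"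
    if ij: "i < n" "j < n" for i j
  proof -
    have "H $$ (i, j) = fact d * \<epsilon> ^ (ptrunc (vs ! i) (ptrunc (vs ! j) N) E - 1)
      * q ^ (sq_sum V m + 2 * lkp m (vs ! i) + 2 * lkp m (vs ! j) + 2 + (if vs ! i = vs ! j then 2 else 0))"
      using hessian_approx_poly[OF r V(1) vsV[OF ij(1)] vsV[OF ij(2)] _ _ d, of Fs \<epsilon> q] Fs ij
      unfolding H_def hessian_def Let_def vs_def[symmetric] N_def m_def n_def by simp
    thus ?thesis unfolding A_eq[OF ij] vs_inj[OF ij] K_def y_def
      by (auto simp: power_add power_mult power2_eq_square)
  qed
  have "signature_lorentz n H"
  proof (rule signature_lorentzI[OF H])
    show "H\<^sup>T = H"
    proof (rule eq_matI)
      fix i j assume "i < dim_row H" "j < dim_col H"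
      hence ij: "i < n" "j < n" using H by auto
      thus "H\<^sup>T $$ (i, j) = H $$ (i, j)"
        using H H_entry[OF ij] H_entry[OF ij(2,1)] A_sym[of i j] by (simp add: mult_ac)
    qed (use H in auto)
    show "vec n (\<lambda>i. w i * y i) \<in> carrier_vec n" by simp
    show "0 < (\<Sum>i<n. H $$ (i, i))"
      using n0 K y A_diag q by (intro sum_pos) (auto simp: H_entry)
    fix x :: "real vec" assume x: "x \<in> carrier_vec n" "x \<noteq> 0\<^sub>v n" "vec n (\<lambda>i. w i * y i) \<bullet> x = 0"
    define z where "z i = y i * x $ i" for i
    have "x \<bullet> (H *\<^sub>v x) = (\<Sum>i<n. \<Sum>j<n. x $ i * (H $$ (i, j) * x $ j))"
      using x(1) H by (auto simp: scalar_prod_def sum_distrib_left atLeast0LessThan intro!: sum.cong)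
    also have "\<dots> = K * (\<Sum>i<n. \<Sum>j<n. z i * z j * A i j * (if i = j then q\<^sup>2 else 1))"
      unfolding sum_distrib_left by (intro sum.cong) (auto simp: H_entry z_def)
    also have "\<dots> < 0"
    proof -
      have "(\<Sum>i<n. \<Sum>j<n. z i * z j * A i j * (if i = j then q\<^sup>2 else 1)) < 0"
      proof (rule damped_form_negative[where c = "1 - \<epsilon>" and P = P and g = g and w = w])
        show "q\<^sup>2 < 1" using q by (simp add: power_less_one_iff)
        show "(\<Sum>i<n. w i * z i) = 0"
          using x(1,3) by (simp add: scalar_prod_def atLeast0LessThan z_def mult_ac)
        show "\<exists>i\<in>{..<n}. z i \<noteq> 0"
        proof (rule ccontr)
          assume "\<not> ?thesis"
          hence "x = 0\<^sub>v n" using x(1) y by (intro eq_vecI) (auto simp: z_def less_le)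
          thus False using x(2) by simp
        qed
      qed (use \<epsilon> A_diag in \<open>auto simp: A_def\<close>)
      thus ?thesis using K by (simp add: mult_pos_neg)
    qed
    finally show "x \<bullet> (H *\<^sub>v x) < 0" .
  qed
  thus "signature_lorentz (card V) (hessian V (foldr pderiv_var Fs ?f))"
    unfolding n H_def .
qed

text \<open>Stated for an arbitrary rank function, so that the Chow ring enters only through the
  computation of the coefficients.\<close>

theorem lorentzian_truncation_polynomial:
  assumes r: "rank_fun E r" and E: "E \<noteq> {}" and V: "finite V" "V \<subseteq> Pow E" and rE: "r E = d + 1"
    and ne: "2 \<le> d \<Longrightarrow> V \<noteq> {}"
    and f: "\<And>m. lkp f m = (if m \<in> deg_monomials V d
      then fact d / mfact m * of_bool (ptruncs_rank E r m = 1) else 0)"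
  shows "lorentzian V d f"
  unfolding lorentzian_def
proof (intro exI conjI allI)
  \<comment> \<open>Starting at 1/2 keeps both \<open>\<epsilon> k\<close> and
    \<open>q = 1 - \<epsilon> k\<close> strictly between 0 and 1.\<close>
  define \<epsilon> where "\<epsilon> k = 1 / real (k + 2)" for k
  have \<epsilon>: "0 < \<epsilon> k" "\<epsilon> k < 1" for k unfolding \<epsilon>_def by auto
  have \<epsilon>_lim: "\<epsilon> \<longlonglongrightarrow> 0"
    unfolding \<epsilon>_def using LIMSEQ_ignore_initial_segment[OF lim_1_over_n[where 'a = real], of 2] by simp
  let ?f = "\<lambda>k. approx_poly E r V d (\<epsilon> k) (1 - \<epsilon> k)"
  show "strictly_lorentzian V d (?f k)" for k
    using \<epsilon>[of k] by (intro strictly_lorentzian_approx_poly[OF r V rE ne]) auto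
  show "(\<lambda>k. lkp (?f k) m) \<longlonglongrightarrow> lkp f m" for m
  proof (cases "m \<in> deg_monomials V d")
    case True
    obtain Fs where m: "m = monomial Fs" by (rule monomial_exhaust)
    have pos: "1 \<le> ptruncs_rank E r m"
      unfolding m ptruncs_rank_monomial[OF r]
      using rank_fun_pos[OF rank_fun_ptruncs[OF r], of E] E by blast
    have "(\<lambda>k. fact d / mfact m * \<epsilon> k ^ (ptruncs_rank E r m - 1) * (1 - \<epsilon> k) ^ sq_sum V m)
        \<longlonglongrightarrow> fact d / mfact m * 0 ^ (ptruncs_rank E r m - 1) * (1 - 0) ^ sq_sum V m"
      by (intro tendsto_intros \<epsilon>_lim)
    \<comment> \<open>The convention \<open>0 ^ 0 = 1\<close> selects the monomials of remaining
      rank one; positivity of the rank rules out the truncated subtraction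
      \<open>0 - 1 = 0\<close>.\<close>
    moreover have "(0::real) ^ (ptruncs_rank E r m - 1) = of_bool (ptruncs_rank E r m = 1)"
      using pos by (auto simp: power_0_left)
    ultimately show ?thesis using True unfolding f lookup_approx_poly[OF V(1)] by simp
  next
    case False
    thus ?thesis unfolding f lookup_approx_poly[OF V(1)] by simp
  qed
qed

section \<open>The degree map of the Chow ring\<close>

text \<open>Moebius inversion as a triangular system: sets are added by decreasing cardinality, so a
  new set \<open>X\<close> contains no other set already treated, and its value does not disturb the
  equations solved before.\<close>

lemma up_sums_solvable:
  fixes a :: "'a set \<Rightarrow> 'b::ab_group_add"
  assumes "finite E" "P \<subseteq> Pow E"
  shows "\<exists>\<xi>. \<forall>F\<in>P. (\<Sum>K\<in>{K\<in>P. F \<subseteq> K}. \<xi> K) = a F"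
proof -
  have "finite P" using assms finite_subset by blast
  thus ?thesis using assms(2)
  proof (induction P rule: finite_ranking_induct[where f = "\<lambda>F. - int (card F)"])
    case (insert X P)
    show ?case
    proof (cases "X \<in> P")
      case False
      obtain \<xi> where \<xi>: "\<forall>F\<in>P. (\<Sum>K\<in>{K\<in>P. F \<subseteq> K}. \<xi> K) = a F"
        using insert by auto
      define \<eta> where "\<eta> = \<xi>(X := a X - (\<Sum>K\<in>{K\<in>P. X \<subseteq> K}. \<xi> K))"
      have same: "(\<Sum>K\<in>{K\<in>P. F \<subseteq> K}. \<eta> K) = (\<Sum>K\<in>{K\<in>P. F \<subseteq> K}. \<xi> K)" for F
        using False by (intro sum.cong) (auto simp: \<eta>_def)
      have "(\<Sum>K\<in>{K\<in>insert X P. F \<subseteq> K}. \<eta> K) = a F" if F: "F \<in> insert X P" for F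
      proof (cases "F = X")
        case True
        have "{K\<in>insert X P. F \<subseteq> K} = insert X {K\<in>P. X \<subseteq> K}" using True by auto
        thus ?thesis using True False insert.hyps(1) same[of X] by (simp add: \<eta>_def)
      next
        case ne: False
        have "\<not> F \<subseteq> X"
        proof
          assume "F \<subseteq> X"
          moreover have "finite X" using insert.prems assms(1) finite_subset by auto
          moreover have "card X \<le> card F" using insert.hyps(2)[of F] F ne by auto
          ultimately show False using ne card_seteq by metis
        qed
        hence "{K\<in>insert X P. F \<subseteq> K} = {K\<in>P. F \<subseteq> K}" by auto
        thus ?thesis using \<xi> F ne same[of F] by simp
      qed
      thus ?thesis by blast
    qed (use insert in \<open>auto simp: insert_absorb\<close>)
  qed simp
qed

text \<open>Uniqueness for the same triangular system, from large sets downwards. It allows an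
  identity about the x-classes to be verified on the h-classes.\<close>

lemma up_sums_determine:
  fixes f g :: "'a set \<Rightarrow> 'b::ab_group_add"
  assumes "finite E" "P \<subseteq> Pow E"
    and eq: "\<And>F. F \<in> P \<Longrightarrow> (\<Sum>K\<in>{K\<in>P. F \<subseteq> K}. f K) = (\<Sum>K\<in>{K\<in>P. F \<subseteq> K}. g K)"
    and "F \<in> P"
  shows "f F = g F"
  using assms(4)
proof (induction "card E - card F" arbitrary: F rule: less_induct)
  case less
  have finP: "finite P" using assms(1,2) finite_subset by blast
  have FE: "F \<subseteq> E" using less.prems assms(2) by auto
  let ?S = "{K\<in>P. F \<subset> K}"
  have S: "{K\<in>P. F \<subseteq> K} = insert F ?S" using less.prems by auto
  have "(\<Sum>K\<in>?S. f K) = (\<Sum>K\<in>?S. g K)"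
  proof (intro sum.cong refl less.hyps)
    fix K assume K: "K \<in> ?S"
    hence "K \<subseteq> E" using assms(2) by auto
    hence "card F < card K" "card K \<le> card E"
      using K assms(1) by (auto intro: psubset_card_mono card_mono finite_subset)
    thus "card E - card K < card E - card F" by linarith
  qed auto
  thus ?case using eq[OF less.prems] finP unfolding S by simp
qed

section \<open>Flats of a loopless matroid and the candidate degree map\<close>

locale loopless_matroid =
  fixes E :: "'a set" and indep :: "'a set \<Rightarrow> bool" and d :: nat
  assumes M: "matroid E indep" and LL: "loopless E indep" and rank_E: "mrank indep E = d + 1"
begin

abbreviation "r \<equiv> mrank indep"
abbreviation "np \<equiv> np_flats E indep"

lemma rank_fun_r: "rank_fun E r"
  by (rule rank_fun_mrank[OF M LL])

lemma finite_E: "finite E"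
  by (rule matroid_finite[OF M])

lemma E_nonempty: "E \<noteq> {}"
  using rank_E mrank_empty[OF M] by auto

lemma np_subset: "np \<subseteq> Pow E"
  unfolding np_flats_def is_flat_def by auto

lemma finite_np: "finite np"
  using np_subset finite_E finite_subset by blast

lemma flat_in_np:
  "F \<in> np \<longleftrightarrow> F \<subseteq> E \<and> F \<noteq> {} \<and> F \<noteq> E \<and> (\<forall>e\<in>E - F. r F < r (insert e F))"
  unfolding np_flats_def is_flat_def by auto

lemma np_rank_less:
  assumes F: "F \<in> np" and G: "F \<subset> G" "G \<subseteq> E"
  shows "r F < r G"
proof -
  obtain e where e: "e \<in> G - F" using G by auto
  hence "r F < r (insert e F)" using F G by (auto simp: flat_in_np)
  also have "\<dots> \<le> r G" using e G by (intro rank_fun_mono[OF rank_fun_r]) auto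
  finally show ?thesis .
qed

lemma np_rank_pos: "F \<in> np \<Longrightarrow> 1 \<le> r F"
  using rank_fun_pos[OF rank_fun_r, of F] by (simp add: flat_in_np)

lemma np_rank_le: "F \<in> np \<Longrightarrow> r F \<le> d"
  using np_rank_less[of F E] rank_E unfolding flat_in_np psubset_eq by simp

text \<open>Both flats are the closure of \<open>S\<close>.\<close>

lemma np_eq_of_rank:
  assumes F: "F \<in> np" and G: "G \<in> np" and S: "S \<subseteq> F" "S \<subseteq> G" and "r S = r F" "r S = r G"
  shows "F = G"
proof -
  have "S \<subseteq> E" using F S by (auto simp: flat_in_np)
  from unique_flat_of_rank[OF rank_fun_r finite_E this] show ?thesis
    using assms by (auto simp: flat_in_np)
qed

text \<open>The degree map is computed in the polynomial ring on the classes \<open>h\<^sub>F\<close>. Since \<open>h\<^sub>F = 0\<close>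
  in the Chow ring when \<open>F\<close> has rank one, \<open>hv\<close> sends such \<open>F\<close> to zero; \<open>xi F\<close> is the class
  \<open>x\<^sub>F\<close> expressed through the \<open>h\<close>, by Moebius inversion of
  \<open>\<Sum>\<^bsub>F \<subseteq> K \<noteq> E\<^esub> x\<^sub>K = h\<^sub>E - h\<^sub>F\<close>.\<close>

definition hv :: "'a set \<Rightarrow> 'a set rpoly" where
  "hv F = (if 2 \<le> r F then pvar F else 0)"

definition xi :: "'a set \<Rightarrow> 'a set rpoly" where
  "xi = (SOME \<xi>. \<forall>F\<in>np. (\<Sum>K\<in>{K\<in>np. F \<subseteq> K}. \<xi> K) = hv E - hv F)"

lemma xi: "F \<in> np \<Longrightarrow> (\<Sum>K\<in>{K\<in>np. F \<subseteq> K}. xi K) = hv E - hv F"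
  unfolding xi_def
  using someI_ex[OF up_sums_solvable[OF finite_E np_subset, of "\<lambda>F. hv E - hv F"]] by blast

text \<open>The rank \<open>d + 1\<close> drops to one in \<open>d\<close> steps exactly when no
  step is trivial. In particular a monomial of degree \<open>d\<close> containing a set of rank
  below two gets the value 0, in accordance with \<open>hv\<close>.\<close>

definition beta :: "('a set \<Rightarrow>\<^sub>0 nat) \<Rightarrow> real" where
  "beta m = of_bool (kys m \<subseteq> Pow E \<and> mdeg m = d \<and> ptruncs_rank E r m = 1)"

abbreviation "hdeg \<equiv> lin_ext beta"
abbreviation "Psi \<equiv> \<lambda>p. hdeg (poly_subst xi p)"

lemma beta_monomial:
  "beta (monomial Fs) = of_bool (set Fs \<subseteq> Pow E \<and> length Fs = d \<and> ptruncs Fs r E = 1)"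
  by (simp add: beta_def ptruncs_rank_monomial[OF rank_fun_r])

section \<open>Compatibility with the relations of the Chow ring\<close>

text \<open>\<open>P\<close> is the closure of the point \<open>i\<close>. It turns a sum over the
  flats through \<open>i\<close> into an up-sum, to which the defining equation of \<open>xi\<close>
  applies.\<close>

lemma rank1_flat_through:
  assumes "i \<in> E"
  obtains P where "P \<in> rank1_flats E r" "i \<in> P" "\<forall>F\<in>np. i \<in> F \<longleftrightarrow> P \<subseteq> F"
proof -
  have "r {i} = 1" using mrank_singleton[OF M LL assms] .
  then obtain P where P: "P \<in> rank1_flats E r" "{i} \<subseteq> P"
    using unique_rank1_flat[OF rank_fun_r finite_E, of "{i}"] assms by auto
  have "P \<subseteq> F" if F: "F \<in> np" "i \<in> F" for F
  proof
    fix e assume e: "e \<in> P"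
    have "r {i} \<le> r ({i} \<union> {e})" "r ({i} \<union> {e}) \<le> r P"
      by (rule rank_fun_mono[OF rank_fun_r], use e P in auto)+
    hence "r ({i} \<union> {e}) = r {i}" using P(1) \<open>r {i} = 1\<close> unfolding rank1_flats_def by auto
    hence "r (F \<union> {e}) = r F" by (rule rank_fun_Un_eq[OF rank_fun_r]) (use F in auto)
    moreover have "e \<in> E" using e P(1) unfolding rank1_flats_def by auto
    ultimately show "e \<in> F" using F(1) unfolding flat_in_np by force
  qed
  thus ?thesis using P(2) by (intro that[OF P(1)]) auto
qed

text \<open>A flat of rank one has \<open>hv\<close> equal to 0, so the up-sum does not depend on
  \<open>i\<close>; this is the linear relation of the Chow ring.\<close>

lemma xi_sum_point:
  assumes "i \<in> E"
  shows "(\<Sum>K\<in>{K\<in>np. i \<in> K}. xi K) = hv E"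
proof -
  obtain P where P: "P \<in> rank1_flats E r" "i \<in> P" "\<forall>F\<in>np. i \<in> F \<longleftrightarrow> P \<subseteq> F"
    by (rule rank1_flat_through[OF assms])
  have rP: "r P = 1" using P(1) unfolding rank1_flats_def by auto
  have eq: "{K\<in>np. i \<in> K} = {K\<in>np. P \<subseteq> K}" using P(3) by auto
  show ?thesis
  proof (cases "P = E")
    \<comment> \<open>This is total rank one: there are no flats to sum over, and
      \<open>hv E\<close> is 0 as well.\<close>
    case True
    hence none: "{K\<in>np. P \<subseteq> K} = {}" by (auto simp: flat_in_np)
    show ?thesis unfolding eq none using True rP by (simp add: hv_def)
  next
    case False
    hence "P \<in> np" using P(1,2) unfolding rank1_flats_def flat_in_np by auto
    thus ?thesis unfolding eq using xi[of P] rP by (simp add: hv_def)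
  qed
qed

text \<open>Primed functions are the values on the \<open>x\<^sub>F\<close> of linear functionals given on the \<open>h\<^sub>F\<close>.\<close>

lemma pairing_dual:
  fixes s s' :: "'a set \<Rightarrow> real" and l l' :: "'b \<Rightarrow> 'a set \<Rightarrow> real"
  assumes T: "\<And>F G. F \<in> insert E np \<Longrightarrow> G \<in> insert E np \<Longrightarrow>
      hdeg (Q * hv F * hv G) = s F * s G - (\<Sum>L\<in>Ls. l L F * l L G)"
    and s': "\<And>F. F \<in> np \<Longrightarrow> (\<Sum>K\<in>{K\<in>np. F \<subseteq> K}. s' K) = s E - s F"
    and l': "\<And>F L. L \<in> Ls \<Longrightarrow> F \<in> np \<Longrightarrow> (\<Sum>K\<in>{K\<in>np. F \<subseteq> K}. l' L K) = l L E - l L F"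
    and F: "F \<in> np" and G: "G \<in> np"
  shows "hdeg (Q * xi F * xi G) = s' F * s' G - (\<Sum>L\<in>Ls. l' L F * l' L G)"
proof -
  have up: "(\<Sum>K\<in>{K\<in>np. F \<subseteq> K}. s' K * b - (\<Sum>L\<in>Ls. l' L K * c L))
      = (s E - s F) * b - (\<Sum>L\<in>Ls. (l L E - l L F) * c L)" if "F \<in> np" for F b c
  proof -
    have "(\<Sum>K\<in>{K\<in>np. F \<subseteq> K}. \<Sum>L\<in>Ls. l' L K * c L) = (\<Sum>L\<in>Ls. (l L E - l L F) * c L)"
      by (subst sum.swap) (simp add: l'[OF _ that] flip: sum_distrib_right)
    thus ?thesis by (simp add: sum_subtractf s'[OF that] flip: sum_distrib_right)
  qed
  \<comment> \<open>The arguments are converted one at a time. The unconverted one ranges over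
    \<open>insert E np\<close> because the inversion formula also involves
    \<open>hv E\<close>.\<close>
  have 1: "hdeg (Q * xi F * hv G) = s' F * s G - (\<Sum>L\<in>Ls. l' L F * l L G)"
    if F: "F \<in> np" and G: "G \<in> insert E np" for F G
  proof (rule up_sums_determine[OF finite_E np_subset _ F])
    fix F assume F: "F \<in> np"
    have "(\<Sum>K\<in>{K\<in>np. F \<subseteq> K}. hdeg (Q * xi K * hv G)) = hdeg (Q * (hv E - hv F) * hv G)"
      by (simp add: xi[OF F, symmetric] sum_distrib_left sum_distrib_right lin_ext_sum)
    also have "\<dots> = hdeg (Q * hv E * hv G) - hdeg (Q * hv F * hv G)"
      by (simp add: algebra_simps lin_ext_diff)
    also have "\<dots> = (s E - s F) * s G - (\<Sum>L\<in>Ls. (l L E - l L F) * l L G)"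
      using T[of E G] T[of F G] F G by (simp add: left_diff_distrib sum_subtractf)
    finally show "(\<Sum>K\<in>{K\<in>np. F \<subseteq> K}. hdeg (Q * xi K * hv G))
        = (\<Sum>K\<in>{K\<in>np. F \<subseteq> K}. s' K * s G - (\<Sum>L\<in>Ls. l' L K * l L G))"
      unfolding up[OF F] .
  qed
  have "hdeg (Q * xi F * xi G) = s' G * s' F - (\<Sum>L\<in>Ls. l' L G * l' L F)"
  proof (rule up_sums_determine[OF finite_E np_subset _ G])
    fix G assume G: "G \<in> np"
    have "(\<Sum>K\<in>{K\<in>np. G \<subseteq> K}. hdeg (Q * xi F * xi K)) = hdeg (Q * xi F * (hv E - hv G))"
      by (simp add: xi[OF G, symmetric] sum_distrib_left lin_ext_sum)
    also have "\<dots> = hdeg (Q * xi F * hv E) - hdeg (Q * xi F * hv G)"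
      by (simp add: algebra_simps lin_ext_diff)
    also have "\<dots> = (s E - s G) * s' F - (\<Sum>L\<in>Ls. (l L E - l L G) * l' L F)"
      using 1[OF F, of E] 1[OF F, of G] G
      by (simp add: left_diff_distrib right_diff_distrib sum_subtractf mult.commute)
    finally show "(\<Sum>K\<in>{K\<in>np. G \<subseteq> K}. hdeg (Q * xi F * xi K))
        = (\<Sum>K\<in>{K\<in>np. G \<subseteq> K}. s' K * s' F - (\<Sum>L\<in>Ls. l' L K * l' L F))"
      unfolding up[OF G] .
  qed
  thus ?thesis by (simp add: mult.commute)
qed

text \<open>An element that does not raise \<open>r\<close> does not raise a truncation of it
  either, so flats of the truncation are flats of the matroid.\<close>

lemma truncated_flat_in_np:
  assumes "L \<subseteq> E" "L \<noteq> {}" "L \<noteq> E"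
    and "\<And>e. e \<in> E - L \<Longrightarrow> ptruncs Fs r L < ptruncs Fs r (insert e L)"
  shows "L \<in> np"
  unfolding flat_in_np
proof (intro conjI ballI)
  fix e assume e: "e \<in> E - L"
  have "r (L \<union> {e}) \<noteq> r L"
    using ptruncs_Un_eq[OF rank_fun_r, of L "{e}" Fs] assms(4)[OF e] by auto
  moreover have "r L \<le> r (L \<union> {e})" by (rule rank_fun_mono[OF rank_fun_r]) auto
  ultimately show "r L < r (insert e L)" by simp
qed (use assms in auto)

text \<open>The Moebius inverses of the functionals in \<open>rank3_pairing\<close>. A set of rank
  one lies in exactly one point and a set of larger rank in none; a point containing
  \<open>F\<close> lies on the line \<open>L\<close> as soon as \<open>F\<close> does.\<close>

lemma rank3_dual:
  assumes N: "N = ptruncs Fs r" and NE: "N E = 3" and F: "F \<in> np"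
  shows "(\<Sum>K\<in>{K\<in>np. F \<subseteq> K}. of_bool (K \<in> rank1_flats E N) :: real) = 1 - of_bool (2 \<le> N F)"
    and "L \<in> rank2_flats E N \<Longrightarrow>
      (\<Sum>K\<in>{K\<in>np. F \<subseteq> K}. of_bool (K \<in> rank1_flats E N \<and> K \<subseteq> L) - of_bool (K = L) :: real)
        = - of_bool (2 \<le> N F \<and> F \<subseteq> L)"
proof -
  have rN: "rank_fun E N" unfolding N by (rule rank_fun_ptruncs[OF rank_fun_r])
  have FE: "F \<subseteq> E" "F \<noteq> {}" using F by (auto simp: flat_in_np)
  have N1: "1 \<le> N F" using rank_fun_pos[OF rN FE] .
  have fin: "finite {K\<in>np. F \<subseteq> K}" using finite_np by simp
  have big: "K \<notin> rank1_flats E N" if "2 \<le> N F" "F \<subseteq> K" for K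
    using that rank_fun_mono[OF rN, of F K] unfolding rank1_flats_def by auto
  \<comment> \<open>Total rank three keeps points, and likewise lines, different from
    \<open>E\<close>, so they occur among the proper flats of the sum.\<close>
  have pt_np: "K \<in> np" if "K \<in> rank1_flats E N" "F \<subseteq> K" for K
    using that FE(2) NE unfolding rank1_flats_def
    by (intro truncated_flat_in_np[where Fs = Fs]) (auto simp: N[symmetric])
  have pt: "\<exists>!K. K \<in> rank1_flats E N \<and> F \<subseteq> K" if "\<not> 2 \<le> N F"
    using that N1 by (intro unique_rank1_flat[OF rN finite_E FE(1)]) auto
  show "(\<Sum>K\<in>{K\<in>np. F \<subseteq> K}. of_bool (K \<in> rank1_flats E N) :: real) = 1 - of_bool (2 \<le> N F)"
  proof (cases "2 \<le> N F")
    case True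
    hence "of_bool (K \<in> rank1_flats E N) = (0::real)" if "K \<in> {K\<in>np. F \<subseteq> K}" for K
      using that big by auto
    thus ?thesis using True by (simp only: sum.neutral) simp
  next
    case False
    have "\<exists>!K. K \<in> {K\<in>np. F \<subseteq> K} \<and> K \<in> rank1_flats E N" using pt[OF False] pt_np by blast
    from sum_unique[OF fin this] show ?thesis using False by simp
  qed
  assume L: "L \<in> rank2_flats E N"
  have L_np: "L \<in> np" if "F \<subseteq> L"
    using that L FE(2) NE unfolding rank2_flats_def
    by (intro truncated_flat_in_np[where Fs = Fs]) (auto simp: N[symmetric])
  have in_L: "K \<subseteq> L" if K: "K \<in> rank1_flats E N" "F \<subseteq> K" "F \<subseteq> L" for K
  proof
    fix e assume e: "e \<in> K"
    have "N F \<le> N (F \<union> {e})" "N (F \<union> {e}) \<le> N K"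
      by (rule rank_fun_mono[OF rN], use e K in auto)+
    hence "N (F \<union> {e}) = N F" using K(1) N1 unfolding rank1_flats_def by auto
    hence "N (L \<union> {e}) = N L" by (rule rank_fun_Un_eq[OF rN]) (use K in auto)
    moreover have "e \<in> E" using e K(1) unfolding rank1_flats_def by auto
    ultimately show "e \<in> L" using L unfolding rank2_flats_def by force
  qed
  have 1: "(\<Sum>K\<in>{K\<in>np. F \<subseteq> K}. of_bool (K = L) :: real) = of_bool (F \<subseteq> L)"
  proof (cases "F \<subseteq> L")
    case True
    thus ?thesis using fin L_np by (simp add: of_bool_def)
  next
    case False
    hence "of_bool (K = L) = (0::real)" if "K \<in> {K\<in>np. F \<subseteq> K}" for K
      using that by auto
    thus ?thesis using False by (simp only: sum.neutral) simp
  qed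
  have 2: "(\<Sum>K\<in>{K\<in>np. F \<subseteq> K}. of_bool (K \<in> rank1_flats E N \<and> K \<subseteq> L) :: real)
      = of_bool (F \<subseteq> L \<and> \<not> 2 \<le> N F)"
  proof (cases "F \<subseteq> L \<and> \<not> 2 \<le> N F")
    case True
    have "\<exists>!K. K \<in> {K\<in>np. F \<subseteq> K} \<and> (K \<in> rank1_flats E N \<and> K \<subseteq> L)"
      using pt True pt_np in_L by blast
    from sum_unique[OF fin this] show ?thesis using True by simp
  next
    case False
    have "(\<Sum>K\<in>{K\<in>np. F \<subseteq> K}. of_bool (K \<in> rank1_flats E N \<and> K \<subseteq> L) :: real) = 0"
      using False big by (intro sum.neutral) auto
    also have "0 = (of_bool (F \<subseteq> L \<and> \<not> 2 \<le> N F) :: real)" using False by simp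
    finally show ?thesis .
  qed
  show "(\<Sum>K\<in>{K\<in>np. F \<subseteq> K}. of_bool (K \<in> rank1_flats E N \<and> K \<subseteq> L) - of_bool (K = L) :: real)
        = - of_bool (2 \<le> N F \<and> F \<subseteq> L)"
    unfolding sum_subtractf 1 2 by (auto simp: of_bool_def)
qed

text \<open>Multiplication by a monomial in the \<open>h\<close> truncates the matroid, so this is a statement about
  two incomparable flats in rank three: it holds because two distinct points lie on exactly one line.\<close>

lemma hdeg_incomparable_monomial:
  assumes F: "F \<in> np" and G: "G \<in> np" and inc: "\<not> F \<subseteq> G" "\<not> G \<subseteq> F"
  shows "hdeg (sng m 1 * xi F * xi G) = 0"
proof -
  obtain Fs where m: "m = monomial Fs" by (rule monomial_exhaust)
  define N where "N = ptruncs Fs r"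
  have rN: "rank_fun E N" unfolding N_def by (rule rank_fun_ptruncs[OF rank_fun_r])
  have prod: "hdeg (sng m 1 * hv A * hv B) =
      of_bool (2 \<le> r A \<and> 2 \<le> r B) * beta (monomial (Fs @ [B, A]))" for A B
  proof (cases "2 \<le> r A \<and> 2 \<le> r B")
    case True
    hence "sng m 1 * hv A * hv B = sng (monomial (Fs @ [B, A])) 1"
      by (simp add: hv_def pvar_def m mult_single add_ac)
    thus ?thesis using True by (simp only: lin_ext_single) simp
  qed (auto simp: hv_def)
  show ?thesis
  proof (cases "set Fs \<subseteq> Pow E \<and> length Fs + 2 = d \<and> N E = 3")
    case True
    let ?s = "\<lambda>A. of_bool (2 \<le> N A) :: real"
    let ?l = "\<lambda>L A. of_bool (2 \<le> N A \<and> A \<subseteq> L) :: real"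
    let ?s' = "\<lambda>A. of_bool (A \<in> rank1_flats E N) :: real"
    let ?l' = "\<lambda>L A. of_bool (A \<in> rank1_flats E N \<and> A \<subseteq> L) - of_bool (A = L) :: real"
    have "hdeg (sng m 1 * xi F * xi G)
        = ?s' F * ?s' G - (\<Sum>L\<in>rank2_flats E N. ?l' L F * ?l' L G)"
    proof (rule pairing_dual[where s = ?s and l = ?l])
      fix A B assume AB: "A \<in> insert E np" "B \<in> insert E np"
      hence AE: "A \<subseteq> E" "B \<subseteq> E" using np_subset by auto
      have le: "N A \<le> r A" for A
      proof -
        have "ptruncs Gs q A \<le> q A" for Gs and q :: "'a set \<Rightarrow> nat"
          by (induction Gs arbitrary: q) (auto intro: order_trans[OF _ ptrunc_le])
        thus ?thesis unfolding N_def .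
      qed
      \<comment> \<open>\<open>hv\<close> cuts off by the original rank, the pairing by the
        truncated one. Since \<open>N\<close> is below \<open>r\<close>, the sets discarded by
        \<open>hv\<close> are trivial for \<open>N\<close> too.\<close>
      have zero: "ptrunc A (ptrunc B N) E \<noteq> 1" if "\<not> (2 \<le> r A \<and> 2 \<le> r B)"
        using that le[of A] le[of B] ptrunc_ptrunc_ground[OF rN AE] True by auto
      have "hdeg (sng m 1 * hv A * hv B) = of_bool (ptrunc A (ptrunc B N) E = 1)"
        unfolding prod beta_monomial using zero True AE by (auto simp: N_def)
      thus "hdeg (sng m 1 * hv A * hv B)
          = ?s A * ?s B - (\<Sum>L\<in>rank2_flats E N. ?l L A * ?l L B)"
        using rank3_pairing[OF rN finite_E _ AE] True by simp
    next
      fix A assume A: "A \<in> np"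
      show "(\<Sum>K\<in>{K\<in>np. A \<subseteq> K}. ?s' K) = ?s E - ?s A"
        using rank3_dual(1)[OF N_def _ A] True by simp
      fix L assume L: "L \<in> rank2_flats E N"
      have "\<not> E \<subseteq> L" using L True unfolding rank2_flats_def by auto
      thus "(\<Sum>K\<in>{K\<in>np. A \<subseteq> K}. ?l' L K) = ?l L E - ?l L A"
        using rank3_dual(2)[OF N_def _ A L] True by simp
    qed fact+
    \<comment> \<open>If one of the two flats is \<open>L\<close> itself, incomparability makes the
      factor of the other one vanish, so only pairs of points on \<open>L\<close>
      contribute.\<close>
    also have "(\<Sum>L\<in>rank2_flats E N. ?l' L F * ?l' L G)
        = (\<Sum>L\<in>rank2_flats E N. ?s' F * ?s' G * of_bool (F \<union> G \<subseteq> L))"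
      using inc by (intro sum.cong) auto
    also have "\<dots> = ?s' F * ?s' G"
    proof (cases "F \<in> rank1_flats E N \<and> G \<in> rank1_flats E N")
      case pts: True
      obtain e where e: "e \<in> G - F" using inc by auto
      have "1 < N (insert e F)" using e pts unfolding rank1_flats_def by blast
      also have "\<dots> \<le> N (F \<union> G)" using e by (intro rank_fun_mono[OF rN]) auto
      finally have "N (F \<union> G) = 2"
        using rank_fun_submod[OF rN, of F G] pts unfolding rank1_flats_def by auto
      moreover have "F \<union> G \<subseteq> E" using F G np_subset by auto
      ultimately have "\<exists>!L. L \<in> rank2_flats E N \<and> F \<union> G \<subseteq> L"
        by (intro unique_rank2_flat[OF rN finite_E])
      from sum_unique[OF finite_rank2_flats[OF finite_E] this]
      show ?thesis unfolding sum_distrib_left[symmetric] by simp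
    qed auto
    finally show ?thesis by simp
  next
    case False
    \<comment> \<open>Either the degree is wrong, or at least rank four remains, which two further
      truncations cannot bring down to one. The zero pairing is then transferred to the
      x-classes.\<close>
    have z: "beta (monomial (Fs @ [B, A])) = 0" if "A \<subseteq> E" "B \<subseteq> E" for A B
    proof (cases "set Fs \<subseteq> Pow E \<and> length Fs + 2 = d")
      case True
      hence "3 \<le> N E" "N E \<noteq> 3"
        using ptruncs_ground_ge[of Fs E r] rank_E False unfolding N_def by auto
      hence "ptrunc A (ptrunc B N) E \<noteq> 1"
        using ptrunc_ptrunc_ground[OF rN that] by auto
      thus ?thesis unfolding beta_monomial N_def by simp
    next
      case False
      thus ?thesis unfolding beta_monomial by auto
    qed
    have "hdeg (sng m 1 * xi F * xi G) = 0 * 0 - (\<Sum>L\<in>({}::unit set). 0 * 0)"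
    proof (rule pairing_dual[where s = "\<lambda>_. 0" and l = "\<lambda>_ _. 0"])
      fix A B assume "A \<in> insert E np" "B \<in> insert E np"
      hence "A \<subseteq> E" "B \<subseteq> E" using np_subset by auto
      thus "hdeg (sng m 1 * hv A * hv B) = 0 * 0 - (\<Sum>L\<in>({}::unit set). 0 * 0)"
        unfolding prod using z by simp
    qed (use F G in auto)
    thus ?thesis by simp
  qed
qed

lemma hdeg_incomparable:
  assumes "F \<in> np" "G \<in> np" "\<not> F \<subseteq> G" "\<not> G \<subseteq> F"
  shows "hdeg (Q * (xi F * xi G)) = 0"
proof (induction Q rule: poly_mapping_add_induct)
  case (single m c)
  have "sng m c * (xi F * xi G) = sng 0 c * (sng m 1 * xi F * xi G)"
    by (simp add: mult.assoc[symmetric] mult_single)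
  thus ?case using hdeg_incomparable_monomial[OF assms] by (simp add: lin_ext_scale)
qed (simp add: distrib_right lin_ext_add)

text \<open>Quadratic generators vanish only after \<open>hdeg\<close>; linear ones vanish already
  under the substitution, both sums being sent to \<open>hv E\<close>.\<close>

lemma Psi_gens:
  assumes "g \<in> chow_gens E indep"
  shows "Psi (q * g) = 0"
  using assms unfolding chow_gens_def
proof (elim UnE CollectE exE conjE)
  fix F G assume "g = pvar F * pvar G" "F \<in> np" "G \<in> np" "\<not> F \<subseteq> G" "\<not> G \<subseteq> F"
  thus ?thesis using hdeg_incomparable by (simp add: poly_subst_mult)
next
  fix i j assume "g = (\<Sum>F\<in>{F\<in>np. i \<in> F}. pvar F) - (\<Sum>F\<in>{F\<in>np. j \<in> F}. pvar F)"
    "i \<in> E" "j \<in> E"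
  thus ?thesis by (simp add: poly_subst_mult poly_subst_diff poly_subst_sum xi_sum_point)
qed

lemma Psi_ideal: "p \<in> chow_ideal E indep \<Longrightarrow> Psi p = 0"
  by (induction rule: chow_ideal.induct) (simp_all add: poly_subst_add lin_ext_add Psi_gens)

subsection \<open>Maximal chains and uniqueness of the degree map\<close>

abbreviation point_sum :: "'a \<Rightarrow> 'a set rpoly" where
  "point_sum i \<equiv> \<Sum>K\<in>{K\<in>np. i \<in> K}. pvar K"

lemma poly_subst_point_sum: "i \<in> E \<Longrightarrow> poly_subst xi (point_sum i) = hv E"
  by (simp add: poly_subst_sum xi_sum_point)

lemma some_point: "(SOME i. i \<in> E) \<in> E"
  using E_nonempty by (simp add: some_in_eq)

lemma poly_subst_alpha: "poly_subst xi (chow_alpha E indep) = hv E"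
  unfolding chow_alpha_def by (rule poly_subst_point_sum[OF some_point])

text \<open>\<alpha> may be expanded at any point. A suitable choice of the point drives the
  computations with chains.\<close>

lemma Psi_alpha:
  assumes "i \<in> E"
  shows "Psi (q * chow_alpha E indep) = (\<Sum>K\<in>{K\<in>np. i \<in> K}. Psi (q * pvar K))"
proof -
  have "Psi (q * chow_alpha E indep) = Psi (q * point_sum i)"
    by (simp only: poly_subst_mult poly_subst_alpha poly_subst_point_sum[OF assms])
  thus ?thesis by (simp add: sum_distrib_left poly_subst_sum lin_ext_sum)
qed

lemma Psi_incomparable:
  assumes "F \<in> np" "G \<in> np" "\<not> F \<subseteq> G" "\<not> G \<subseteq> F"
  shows "Psi (q * pvar F * pvar G) = 0"
  using hdeg_incomparable[OF assms, of "poly_subst xi q"]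
  by (simp add: poly_subst_mult mult.assoc)

text \<open>Expanding one factor \<alpha> at a point outside \<open>F\<close> leaves only flats
  strictly above \<open>F\<close>. Each factor thus raises the rank, which cannot exceed
  \<open>d\<close>.\<close>

lemma Psi_alpha_power_eq_0:
  assumes "F \<in> np" "d < r F + k"
  shows "Psi (q * chow_alpha E indep ^ k * pvar F) = 0"
  using assms
proof (induction k arbitrary: F q)
  case 0
  thus ?case using np_rank_le[of F] by simp
next
  case (Suc k)
  obtain i where i: "i \<in> E" "i \<notin> F" using Suc.prems(1) unfolding flat_in_np by auto
  have "Psi (q * chow_alpha E indep ^ Suc k * pvar F)
      = Psi ((q * chow_alpha E indep ^ k * pvar F) * chow_alpha E indep)"
    by (simp add: mult_ac)
  also have "\<dots> = (\<Sum>K\<in>{K\<in>np. i \<in> K}. Psi ((q * chow_alpha E indep ^ k * pvar F) * pvar K))"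
    by (rule Psi_alpha[OF i(1)])
  also have "\<dots> = 0"
  proof (rule sum.neutral, rule ballI)
    fix K assume K: "K \<in> {K\<in>np. i \<in> K}"
    show "Psi ((q * chow_alpha E indep ^ k * pvar F) * pvar K) = 0"
    proof (cases "F \<subseteq> K")
      case True
      hence "r F < r K" using K i by (intro np_rank_less[OF Suc.prems(1)]) (auto simp: flat_in_np)
      hence "Psi ((q * pvar F) * chow_alpha E indep ^ k * pvar K) = 0"
        using Suc.prems(2) K by (intro Suc.IH) auto
      moreover have "(q * chow_alpha E indep ^ k * pvar F) * pvar K
          = q * pvar F * chow_alpha E indep ^ k * pvar K" by (simp only: mult_ac)
      ultimately show ?thesis by (simp only:)
    next
      case False
      thus ?thesis using K i by (intro Psi_incomparable[OF Suc.prems(1)]) auto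
    qed
  qed
  finally show ?case .
qed

lemma chain_rank_bound:
  "sorted_wrt (\<subset>) (F # Fs) \<Longrightarrow> set (F # Fs) \<subseteq> np \<Longrightarrow> r F + length Fs \<le> d"
proof (induction Fs arbitrary: F)
  case Nil
  thus ?case using np_rank_le by simp
next
  case (Cons G Fs)
  hence "r G + length Fs \<le> d" by auto
  moreover have "r F < r G" using Cons.prems by (intro np_rank_less) (auto simp: flat_in_np)
  ultimately show ?case by simp
qed

text \<open>The rank condition makes the chain saturated above \<open>F\<close>. With \<alpha>
  expanded at a point of \<open>G\<close> outside \<open>F\<close>, a flat containing
  \<open>F\<close> and that point either is their closure \<open>G\<close> or has too large a rank
  for the remaining power of \<alpha>.\<close>

lemma Psi_chain:
  assumes "sorted_wrt (\<subset>) (F # Fs)" "set (F # Fs) \<subseteq> np" "r F + length Fs = d"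
  shows "Psi (q * chow_alpha E indep ^ length Fs * pvar F) = Psi (q * prod_list (map pvar (F # Fs)))"
  using assms
proof (induction Fs arbitrary: F q)
  case (Cons G Fs)
  let ?\<alpha> = "chow_alpha E indep" and ?k = "length Fs"
  have F: "F \<in> np" and G: "G \<in> np" and FG: "F \<subset> G" using Cons.prems by auto
  have rG: "r F < r G" using G by (intro np_rank_less[OF F FG]) (auto simp: flat_in_np)
  have "r G + ?k \<le> d" using Cons.prems by (intro chain_rank_bound) auto
  hence rG1: "r G = r F + 1" "r G + ?k = d" using rG Cons.prems(3) by auto
  obtain i where i: "i \<in> G" "i \<notin> F" using FG by auto
  have iE: "i \<in> E" using i G by (auto simp: flat_in_np)
  let ?q = "q * ?\<alpha> ^ ?k * pvar F"
  have assoc: "?q * pvar K = (q * pvar F) * ?\<alpha> ^ ?k * pvar K" for K by (simp only: mult_ac)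
  have "Psi (q * ?\<alpha> ^ length (G # Fs) * pvar F) = Psi (?q * ?\<alpha>)"
    by (simp add: mult_ac)
  also have "\<dots> = (\<Sum>K\<in>{K\<in>np. i \<in> K}. Psi (?q * pvar K))"
    by (rule Psi_alpha[OF iE])
  also have "\<dots> = (\<Sum>K\<in>{G}. Psi (?q * pvar K))"
  proof (rule sum.mono_neutral_right)
    show "\<forall>K\<in>{K\<in>np. i \<in> K} - {G}. Psi (?q * pvar K) = 0"
    proof
      fix K assume K: "K \<in> {K\<in>np. i \<in> K} - {G}"
      show "Psi (?q * pvar K) = 0"
      proof (cases "F \<subseteq> K")
        case True
        have FK: "F \<subset> K" using True K i by auto
        have FI: "insert i F \<subseteq> K" "insert i F \<subseteq> G" using True K FG i by auto
        have lt: "r F < r (insert i F)" using F i iE by (auto simp: flat_in_np)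
        have leK: "r (insert i F) \<le> r K" and leG: "r (insert i F) \<le> r G"
          by (rule rank_fun_mono[OF rank_fun_r FI(1)], rule rank_fun_mono[OF rank_fun_r FI(2)])
        have "r K \<noteq> r G"
        proof
          assume "r K = r G"
          hence "r (insert i F) = r K" "r (insert i F) = r G" using lt leG rG1 by auto
          hence "K = G" using K by (intro np_eq_of_rank[OF _ G FI]) auto
          thus False using K by simp
        qed
        hence "d < r K + ?k" using lt leK rG1 by linarith
        thus ?thesis unfolding assoc using K by (intro Psi_alpha_power_eq_0) auto
      next
        case False
        thus ?thesis using K i by (intro Psi_incomparable[OF F]) auto
      qed
    qed
  qed (use finite_np G i in auto)
  also have "\<dots> = Psi ((q * pvar F) * ?\<alpha> ^ ?k * pvar G)" by (simp only: assoc) simp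
  also have "\<dots> = Psi ((q * pvar F) * prod_list (map pvar (G # Fs)))"
    using Cons.prems rG1 by (intro Cons.IH) auto
  finally show ?case by (simp add: mult.assoc)
qed simp

lemma ptruncs_replicate_ground:
  "k < s E \<Longrightarrow> ptruncs (replicate k E) s E = s E - k"
proof (induction k arbitrary: s)
  case (Suc k)
  have "ptrunc E s E = s E - 1" using ptrunc_ground[of E E s] Suc.prems by simp
  thus ?case using Suc by simp
qed simp

lemma Psi_alpha_power: "Psi (chow_alpha E indep ^ d) = 1"
proof -
  have pow: "poly_subst xi (chow_alpha E indep ^ k) = hv E ^ k" for k
    by (induction k) (simp_all add: poly_subst_mult poly_subst_alpha)
  \<comment> \<open>For \<open>d = 0\<close> the class \<open>hv E\<close> is 0, but its zeroth
    power is still 1.\<close>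
  have "hv E ^ d = sng (monomial (replicate d E)) 1"
  proof (cases "d = 0")
    case False
    hence "hv E = pvar E" using rank_E by (simp add: hv_def)
    thus ?thesis using prod_list_pvar[of "replicate d E"] by (simp add: prod_list_replicate)
  qed simp
  hence "Psi (chow_alpha E indep ^ d) = beta (monomial (replicate d E))"
    unfolding pow by simp
  thus ?thesis unfolding beta_monomial using ptruncs_replicate_ground[of d r] rank_E by auto
qed

text \<open>The value comes from the top power of \<alpha>. One factor is expanded at a point of the
  first flat, which has rank one; every other flat through that point has rank at least two and is
  killed by the remaining powers.\<close>

lemma Psi_maximal_chain:
  assumes Fs: "length Fs = d" "set Fs \<subseteq> np" "sorted_wrt (\<subset>) Fs"
  shows "Psi (prod_list (map pvar Fs)) = 1"
proof (cases Fs)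
  case Nil
  thus ?thesis using Psi_alpha_power Fs(1) by simp
next
  case (Cons F Gs)
  let ?\<alpha> = "chow_alpha E indep"
  have F: "F \<in> np" using Fs Cons by auto
  have "r F + length Gs \<le> d" using Fs Cons by (intro chain_rank_bound) auto
  hence rF: "r F = 1" using np_rank_pos[OF F] Fs(1) Cons by simp
  obtain i where i: "i \<in> F" using F by (auto simp: flat_in_np)
  have iE: "i \<in> E" using i F by (auto simp: flat_in_np)
  have d: "?\<alpha> ^ d = ?\<alpha> ^ length Gs * ?\<alpha>" using Fs(1) Cons by auto
  have "1 = Psi (?\<alpha> ^ length Gs * ?\<alpha>)" using Psi_alpha_power unfolding d by simp
  also have "\<dots> = (\<Sum>K\<in>{K\<in>np. i \<in> K}. Psi (?\<alpha> ^ length Gs * pvar K))"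
    by (rule Psi_alpha[OF iE])
  also have "\<dots> = (\<Sum>K\<in>{F}. Psi (?\<alpha> ^ length Gs * pvar K))"
  proof (rule sum.mono_neutral_right)
    show "\<forall>K\<in>{K\<in>np. i \<in> K} - {F}. Psi (?\<alpha> ^ length Gs * pvar K) = 0"
    proof
      fix K assume K: "K \<in> {K\<in>np. i \<in> K} - {F}"
      have "r {i} = 1" by (rule mrank_singleton[OF M LL iE])
      hence "r K \<noteq> 1" using np_eq_of_rank[OF F, of K "{i}"] K i rF by auto
      hence "d < r K + length Gs" using np_rank_pos[of K] K Fs(1) Cons by auto
      thus "Psi (?\<alpha> ^ length Gs * pvar K) = 0"
        using Psi_alpha_power_eq_0[of K "length Gs" 1] K by simp
    qed
  qed (use finite_np F i in auto)
  also have "\<dots> = Psi (prod_list (map pvar Fs))"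
    using Psi_chain[of F Gs 1] Fs Cons rF by simp
  finally show ?thesis by simp
qed

section \<open>Existence and uniqueness of the degree map\<close>

text \<open>The value 0 outside degree \<open>d\<close> is prescribed by
  \<open>is_degree_map\<close>, so that the degree map is determined as a function on all
  polynomials.\<close>

definition chow_functional :: "'a set rpoly \<Rightarrow> real" where
  "chow_functional p = (if chow_deg E indep d p then Psi p else 0)"

lemma chow_deg_add: "chow_deg E indep k p \<Longrightarrow> chow_deg E indep k q \<Longrightarrow> chow_deg E indep k (p + q)"
  unfolding chow_deg_def by (simp add: vars_in_add homog_add)

lemma chow_deg_mult:
  "chow_deg E indep k p \<Longrightarrow> chow_deg E indep n q \<Longrightarrow> chow_deg E indep (k + n) (p * q)"
  unfolding chow_deg_def by (simp add: vars_in_mult homog_mult)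

lemma chow_deg_single: "kys m \<subseteq> np \<Longrightarrow> mdeg m = k \<Longrightarrow> chow_deg E indep k (sng m c)"
  unfolding chow_deg_def by (simp add: vars_in_single homog_single)

lemma chow_deg_zero: "chow_deg E indep k 0"
  unfolding chow_deg_def by simp

lemma chow_deg_sum:
  "(\<And>i. i \<in> I \<Longrightarrow> chow_deg E indep k (p i)) \<Longrightarrow> chow_deg E indep k (\<Sum>i\<in>I. p i)"
  by (induction I rule: infinite_finite_induct) (auto intro: chow_deg_add chow_deg_zero)

lemma chow_deg_scale: "chow_deg E indep k p \<Longrightarrow> chow_deg E indep k (sng 0 c * p)"
  using chow_deg_mult[OF chow_deg_single[of 0 0 c], of k p] by simp

lemma chow_deg_diff:
  assumes "chow_deg E indep k p" "chow_deg E indep k q"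
  shows "chow_deg E indep k (p - q)"
proof -
  have "p - q = p + sng 0 (- 1) * q" by (simp add: single_uminus)
  thus ?thesis using assms by (metis chow_deg_add chow_deg_scale)
qed

lemma chow_deg_pvar: "F \<in> np \<Longrightarrow> chow_deg E indep 1 (pvar F)"
  unfolding pvar_def by (rule chow_deg_single) auto

lemma chow_functional_is_degree_map: "is_degree_map E indep d chow_functional"
  unfolding is_degree_map_def
proof (intro conjI allI impI ballI)
  fix Fs assume Fs: "length Fs = d \<and> set Fs \<subseteq> np \<and> sorted_wrt (\<subset>) Fs"
  hence "chow_deg E indep d (prod_list (map pvar Fs))"
    unfolding prod_list_pvar by (intro chow_deg_single) auto
  thus "chow_functional (prod_list (map pvar Fs)) = 1"
    using Psi_maximal_chain Fs unfolding chow_functional_def by simp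
qed (auto simp: chow_functional_def chow_deg_add chow_deg_scale poly_subst_add lin_ext_add
    poly_subst_scale lin_ext_scale Psi_ideal)

lemma degree_map_sum:
  assumes \<phi>: "is_degree_map E indep d \<phi>" and "finite I"
    and "\<And>i. i \<in> I \<Longrightarrow> chow_deg E indep d (p i)"
  shows "\<phi> (\<Sum>i\<in>I. p i) = (\<Sum>i\<in>I. \<phi> (p i))"
  using assms(2,3)
proof (induction I)
  case empty
  have "\<phi> (sng 0 0 * 0) = 0 * \<phi> 0" using \<phi> chow_deg_zero unfolding is_degree_map_def by blast
  thus ?case by simp
next
  case (insert i I)
  have "\<phi> (p i + (\<Sum>i\<in>I. p i)) = \<phi> (p i) + \<phi> (\<Sum>i\<in>I. p i)"
    using \<phi> insert.prems chow_deg_sum[of I d p] unfolding is_degree_map_def by blast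
  thus ?case using insert by simp
qed

lemma degree_map_scale:
  "is_degree_map E indep d \<phi> \<Longrightarrow> chow_deg E indep d p \<Longrightarrow> \<phi> (sng 0 c * p) = c * \<phi> p"
  unfolding is_degree_map_def by blast

lemma degree_map_ideal:
  assumes "is_degree_map E indep d \<phi>" "g \<in> chow_gens E indep" "vars_in np q" "chow_deg E indep d (q * g)"
  shows "\<phi> (q * g) = 0"
proof -
  have "q * g + 0 \<in> chow_ideal E indep" by (intro chow_ideal.intros assms)
  thus ?thesis using assms unfolding is_degree_map_def by simp
qed

lemma degree_map_linear_relation:
  assumes \<phi>: "is_degree_map E indep d \<phi>" and k: "kys k \<subseteq> np" "mdeg k + 1 = d"
    and pq: "p \<in> E" "q \<in> E"
  shows "(\<Sum>G\<in>np. (of_bool (p \<in> G) - of_bool (q \<in> G)) * \<phi> (sng (k + sng G 1) 1)) = 0"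
proof -
  let ?c = "\<lambda>G. of_bool (p \<in> G) - of_bool (q \<in> G) :: real"
  have deg: "chow_deg E indep d (sng (k + sng G 1) 1)" if "G \<in> np" for G
    using k that keys_add[of k "sng G 1"] by (intro chow_deg_single) (auto simp: mdeg_add)
  have pt: "point_sum i = (\<Sum>G\<in>np. sng 0 (of_bool (i \<in> G)) * pvar G)" for i
    unfolding sum.inter_filter[OF finite_np] by (intro sum.cong) auto
  have "sng k 1 * (point_sum p - point_sum q) = (\<Sum>G\<in>np. sng 0 (?c G) * sng (k + sng G 1) 1)"
    unfolding pt sum_subtractf[symmetric] sum_distrib_left
    by (intro sum.cong) (simp_all add: pvar_def mult_single single_diff right_diff_distrib)
  moreover have "\<phi> (sng k 1 * (point_sum p - point_sum q)) = 0"
  proof (rule degree_map_ideal[OF \<phi>])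
    show "point_sum p - point_sum q \<in> chow_gens E indep" using pq unfolding chow_gens_def by blast
    have dif: "chow_deg E indep 1 (point_sum p - point_sum q)"
      by (intro chow_deg_diff chow_deg_sum chow_deg_pvar) auto
    show "chow_deg E indep d (sng k 1 * (point_sum p - point_sum q))"
      using chow_deg_mult[OF chow_deg_single[OF k(1) refl, of 1] dif] unfolding k(2) .
  qed (use k in \<open>auto intro: vars_in_single\<close>)
  ultimately show ?thesis
    using degree_map_sum[OF \<phi> finite_np, of "\<lambda>G. sng 0 (?c G) * sng (k + sng G 1) 1"] deg
    by (simp add: chow_deg_scale degree_map_scale[OF \<phi>])
qed

lemma chain_list:
  assumes "finite A" "\<And>F G. F \<in> A \<Longrightarrow> G \<in> A \<Longrightarrow> F \<subseteq> G \<or> G \<subseteq> F"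
  shows "\<exists>Fs. set Fs = A \<and> distinct Fs \<and> sorted_wrt (\<subset>) (Fs :: 'a set list)"
  using assms
proof (induction A rule: finite_remove_induct)
  case empty
  show ?case by (intro exI[of _ "[]"]) simp
next
  case (remove A)
  obtain F where F: "F \<in> A" "\<And>G. G \<in> A \<Longrightarrow> G \<subseteq> F \<Longrightarrow> G = F"
    using finite_has_minimal[OF remove.hyps(1,2)] by blast
  have "\<exists>Fs. set Fs = A - {F} \<and> distinct Fs \<and> sorted_wrt (\<subset>) Fs"
    using remove.prems by (intro remove.IH[OF F(1)]) auto
  then obtain Fs where Fs: "set Fs = A - {F}" "distinct Fs" "sorted_wrt (\<subset>) Fs" by blast
  have "F \<subset> G" if "G \<in> A - {F}" for G using that F remove.prems[of F G] by blast
  thus ?case using Fs F(1) by (intro exI[of _ "F # Fs"]) auto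
qed

text \<open>\<open>p\<close> avoids the next smaller member of the chain and \<open>q\<close> lies
  in the next larger one, or in \<open>E\<close>. Hence every member other than \<open>F\<close>
  contains both points or neither, while \<open>F\<close> contains only \<open>p\<close>.\<close>

lemma separating_points:
  assumes A: "finite A" "A \<subseteq> np" and chain: "\<And>F G. F \<in> A \<Longrightarrow> G \<in> A \<Longrightarrow> F \<subseteq> G \<or> G \<subseteq> F"
    and F: "F \<in> A"
  obtains p q where "p \<in> F" "q \<in> E" "q \<notin> F"
    "\<forall>G\<in>A. G \<subset> F \<longrightarrow> p \<notin> G" "\<forall>G\<in>A. F \<subset> G \<longrightarrow> q \<in> G"
proof -
  have "F \<in> np" using F A by blast
  hence FE: "F \<subseteq> E" "F \<noteq> {}" "F \<noteq> E" by (auto simp: flat_in_np)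
  have "\<exists>p\<in>F. \<forall>G\<in>A. G \<subset> F \<longrightarrow> p \<notin> G"
  proof (cases "{G\<in>A. G \<subset> F} = {}")
    case False
    then obtain H where H: "H \<in> A" "H \<subset> F" "\<And>G. G \<in> {G\<in>A. G \<subset> F} \<Longrightarrow> H \<subseteq> G \<Longrightarrow> H = G"
      using finite_has_maximal[of "{G\<in>A. G \<subset> F}"] A(1) by auto
    hence "G \<subseteq> H" if "G \<in> A" "G \<subset> F" for G using chain[of G H] that by blast
    thus ?thesis using H(2) by blast
  qed (use FE in blast)
  then obtain p where p: "p \<in> F" "\<forall>G\<in>A. G \<subset> F \<longrightarrow> p \<notin> G" by blast
  have "\<exists>q\<in>E - F. \<forall>G\<in>A. F \<subset> G \<longrightarrow> q \<in> G"
  proof (cases "{G\<in>A. F \<subset> G} = {}")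
    case False
    then obtain H where H: "H \<in> A" "F \<subset> H" "\<And>G. G \<in> {G\<in>A. F \<subset> G} \<Longrightarrow> G \<subseteq> H \<Longrightarrow> H = G"
      using finite_has_minimal[of "{G\<in>A. F \<subset> G}"] A(1) by auto
    hence "H \<subseteq> G" if "G \<in> A" "F \<subset> G" for G using chain[of G H] that by blast
    moreover have "H \<subseteq> E" using H(1) A(2) np_subset by auto
    ultimately show ?thesis using H(2) by blast
  qed (use FE in blast)
  then obtain q where q: "q \<in> E - F" "\<forall>G\<in>A. F \<subset> G \<longrightarrow> q \<in> G" by blast
  show ?thesis using p q by (intro that[of p q]) auto
qed

text \<open>A repeated factor \<open>x\<^sub>F\<close> of a chain monomial can be exchanged, by the linear relation of two points
  separating \<open>F\<close> from its neighbours in the chain, against factors outside the chain.\<close>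

lemma degree_maps_agree_on_monomials:
  assumes \<phi>: "is_degree_map E indep d \<phi>" and \<psi>: "is_degree_map E indep d \<psi>"
    and m: "kys m \<subseteq> np" "mdeg m = d"
  shows "\<phi> (sng m 1) = \<psi> (sng m 1)"
  using m
\<comment> \<open>An exchange brings a new flat into the monomial, so the number of distinct flats
  grows and is bounded by \<open>card np\<close>.\<close>
proof (induction "card np - card (kys m)" arbitrary: m rule: less_induct)
  case less
  consider (incomparable) F G where "F \<in> kys m" "G \<in> kys m" "\<not> F \<subseteq> G" "\<not> G \<subseteq> F"
    | (chain) "\<And>F G. F \<in> kys m \<Longrightarrow> G \<in> kys m \<Longrightarrow> F \<subseteq> G \<or> G \<subseteq> F" by blast
  thus ?case
  proof cases
    case incomparable
    define k where "k = m - sng F 1 - sng G 1"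
    have "G \<in> kys (m - sng F 1)"
      using incomparable by (auto simp: in_keys_iff lookup_minus lookup_single when_def)
    hence "m = k + sng G 1 + sng F 1"
      unfolding k_def using monomial_minus_single incomparable(1) by metis
    hence prod: "sng m 1 = sng k 1 * (pvar F * pvar G :: 'a set rpoly)"
      by (simp add: pvar_def mult_single add_ac)
    have k: "kys k \<subseteq> np"
      using less.prems(1) unfolding k_def by (auto simp: in_keys_iff lookup_minus)
    have g: "pvar F * pvar G \<in> chow_gens E indep"
      using incomparable less.prems(1) unfolding chow_gens_def by blast
    have "chow_deg E indep d (sng m 1)" using less.prems by (rule chow_deg_single)
    thus ?thesis using degree_map_ideal[OF \<phi> g vars_in_single[OF k]]
      degree_map_ideal[OF \<psi> g vars_in_single[OF k]] unfolding prod by metis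
  next
    case chain
    show ?thesis
    proof (cases "\<forall>F\<in>kys m. lkp m F = 1")
      case True
      obtain Fs where Fs: "set Fs = kys m" "distinct Fs" "sorted_wrt (\<subset>) Fs"
        using chain_list[OF finite_keys chain] by blast
      have "m = monomial Fs"
      proof (rule poly_mapping_eqI)
        fix F
        show "lkp m F = lkp (monomial Fs) F"
          using True Fs(1,2) by (cases "F \<in> kys m")
            (auto simp: lookup_monomial distinct_count_atmost_1 in_keys_iff count_eq_zero_iff)
      qed
      hence "length Fs = d" and "sng m 1 = (prod_list (map pvar Fs) :: 'a set rpoly)"
        using less.prems by (simp_all add: prod_list_pvar)
      moreover have "set Fs \<subseteq> np" using Fs less.prems by simp
      ultimately show ?thesis using \<phi> \<psi> Fs(3) unfolding is_degree_map_def by metis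
    next
      case False
      then obtain F where F: "F \<in> kys m" "lkp m F \<noteq> 1" by blast
      define k where "k = m - sng F 1"
      have mk: "m = k + sng F 1" unfolding k_def using monomial_minus_single[OF F(1)] by simp
      have keys_k: "kys k = kys m"
        using F unfolding k_def by (auto simp: in_keys_iff lookup_minus lookup_single when_def)
      have k: "kys k \<subseteq> np" "mdeg k + 1 = d"
        using less.prems keys_k mk by (auto simp: mdeg_add)
      obtain p q where pq: "p \<in> F" "q \<in> E" "q \<notin> F"
        "\<forall>G\<in>kys m. G \<subset> F \<longrightarrow> p \<notin> G" "\<forall>G\<in>kys m. F \<subset> G \<longrightarrow> q \<in> G"
        by (rule separating_points[OF finite_keys less.prems(1) chain F(1)])
      have FE: "F \<in> np" "p \<in> E" using F pq(1) less.prems(1) np_subset by auto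
      let ?c = "\<lambda>G. of_bool (p \<in> G) - of_bool (q \<in> G) :: real"
      let ?m = "\<lambda>G. sng (k + sng G 1) 1 :: 'a set rpoly"
      \<comment> \<open>Flats already in the chain have coefficient 0 by the choice of
        \<open>p\<close> and \<open>q\<close>; for all others the support is strictly larger and the
        induction hypothesis applies.\<close>
      have other: "?c G * \<phi> (?m G) = ?c G * \<psi> (?m G)" if G: "G \<in> np - {F}" for G
      proof (cases "G \<in> kys m")
        case True
        hence "p \<in> G \<longleftrightarrow> q \<in> G" using pq G chain[OF F(1) True] by blast
        thus ?thesis by simp
      next
        case False
        have ins: "kys (k + sng G 1) = insert G (kys m)"
          unfolding keys_k[symmetric] by (rule keys_add_single)
        hence sub: "kys (k + sng G 1) \<subseteq> np" using less.prems G by auto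
        have "card (kys m) < card (insert G (kys m))" using False by simp
        moreover have "card (insert G (kys m)) \<le> card np"
          using sub ins finite_np by (intro card_mono) auto
        ultimately have "\<phi> (?m G) = \<psi> (?m G)"
          using sub k(2) ins by (intro less.hyps) (auto simp: mdeg_add)
        thus ?thesis by simp
      qed
      have "(\<Sum>G\<in>np. ?c G * \<phi> (?m G)) = (\<Sum>G\<in>np. ?c G * \<psi> (?m G))"
        using degree_map_linear_relation[OF \<phi> k FE(2) pq(2)]
          degree_map_linear_relation[OF \<psi> k FE(2) pq(2)] by simp
      moreover have "(\<Sum>G\<in>np - {F}. ?c G * \<phi> (?m G)) = (\<Sum>G\<in>np - {F}. ?c G * \<psi> (?m G))"
        using other by (rule sum.cong[OF refl])
      \<comment> \<open>The coefficient of \<open>F\<close> is 1, so cancelling the other terms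
        isolates the original monomial.\<close>
      ultimately have "?c F * \<phi> (?m F) = ?c F * \<psi> (?m F)"
        using sum.remove[OF finite_np FE(1), of "\<lambda>G. ?c G * \<phi> (?m G)"]
          sum.remove[OF finite_np FE(1), of "\<lambda>G. ?c G * \<psi> (?m G)"] by linarith
      thus ?thesis using pq(1,3) unfolding mk by simp
    qed
  qed
qed

lemma degree_map_unique:
  assumes \<phi>: "is_degree_map E indep d \<phi>" and \<psi>: "is_degree_map E indep d \<psi>"
  shows "\<phi> = \<psi>"
proof
  fix p
  show "\<phi> p = \<psi> p"
  proof (cases "chow_deg E indep d p")
    case True
    have deg: "kys m \<subseteq> np" "mdeg m = d" if "m \<in> kys p" for m
      using that True unfolding chow_deg_def vars_in_def homog_def by auto
    have p: "p = (\<Sum>m\<in>kys p. sng 0 (lkp p m) * sng m 1)"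
      using poly_mapping_as_sum[of p] by (simp add: mult_single)
    have eq: "\<chi> p = (\<Sum>m\<in>kys p. lkp p m * \<chi> (sng m 1))" if "is_degree_map E indep d \<chi>" for \<chi>
    proof -
      have "\<chi> (\<Sum>m\<in>kys p. sng 0 (lkp p m) * sng m 1) = (\<Sum>m\<in>kys p. \<chi> (sng 0 (lkp p m) * sng m 1))"
        using deg by (intro degree_map_sum[OF that] chow_deg_scale chow_deg_single) auto
      also have "\<dots> = (\<Sum>m\<in>kys p. lkp p m * \<chi> (sng m 1))"
        using deg by (intro sum.cong degree_map_scale[OF that] chow_deg_single) auto
      finally show ?thesis using p by simp
    qed
    show ?thesis unfolding eq[OF \<phi>] eq[OF \<psi>]
      using degree_maps_agree_on_monomials[OF \<phi> \<psi>] deg by (intro sum.cong) auto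
  next
    case False
    thus ?thesis using \<phi> \<psi> unfolding is_degree_map_def by simp
  qed
qed

lemma chow_integral_eq: "chow_integral E indep d = chow_functional"
  unfolding chow_integral_def
  by (rule the_equality) (rule chow_functional_is_degree_map,
    rule degree_map_unique[OF _ chow_functional_is_degree_map])

subsection \<open>Coefficients of the volume polynomial\<close>

text \<open>The substitution undoes the Moebius inversion, so products of the \<open>chow_h\<close>
  become monomials and their integrals are read off from \<open>beta\<close>.\<close>

lemma poly_subst_chow_h:
  assumes "F \<in> flats_ge2 E indep"
  shows "poly_subst xi (chow_h E indep F) = pvar F"
proof -
  have F: "F \<subseteq> E" "2 \<le> r F" "\<forall>e\<in>E - F. r F < r (insert e F)"
    using assms unfolding flats_ge2_def is_flat_def by auto
  have "(\<Sum>K\<in>{K\<in>np. F \<subseteq> K}. xi K) = hv E - hv F"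
  proof (cases "F = E")
    \<comment> \<open>\<open>E\<close> is not a proper flat, so the sum is empty and its h-class is
      \<alpha> itself.\<close>
    case True
    hence none: "{K\<in>np. F \<subseteq> K} = {}" by (auto simp: flat_in_np)
    show ?thesis unfolding none using True by simp
  next
    case False
    have "F \<noteq> {}" using F(2) mrank_empty[OF M] by auto
    hence "F \<in> np" using F False by (simp add: flat_in_np)
    thus ?thesis by (rule xi)
  qed
  thus ?thesis unfolding chow_h_def using F(2)
    by (simp add: poly_subst_diff poly_subst_alpha poly_subst_sum hv_def)
qed

lemma chow_deg_chow_h: "chow_deg E indep 1 (chow_h E indep F)"
  unfolding chow_h_def chow_alpha_def
  by (intro chow_deg_diff chow_deg_sum chow_deg_pvar) auto

lemma chow_deg_h_product: "chow_deg E indep (length Fs) (prod_list (map (chow_h E indep) Fs))"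
proof (induction Fs)
  case Nil
  show ?case using chow_deg_single[of 0 0 1] by simp
next
  case (Cons F Fs)
  thus ?case using chow_deg_mult[OF chow_deg_chow_h Cons.IH] by simp
qed

lemma chow_integral_h_product:
  assumes "set Fs \<subseteq> flats_ge2 E indep" "length Fs = d"
  shows "chow_integral E indep d (prod_list (map (chow_h E indep) Fs)) = of_bool (ptruncs Fs r E = 1)"
proof -
  have "map (poly_subst xi) (map (chow_h E indep) Fs) = map pvar Fs"
    using assms(1) by (simp add: subset_iff poly_subst_chow_h)
  hence "poly_subst xi (prod_list (map (chow_h E indep) Fs)) = prod_list (map pvar Fs)"
    unfolding poly_subst_prod_list by (rule arg_cong)
  moreover have "set Fs \<subseteq> Pow E" using assms(1) unfolding flats_ge2_def is_flat_def by auto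
  ultimately show ?thesis
    unfolding chow_integral_eq chow_functional_def
    using assms(2) chow_deg_h_product[of Fs] unfolding prod_list_pvar by (auto simp: beta_monomial)
qed

lemma finite_flats_ge2: "finite (flats_ge2 E indep)"
  and flats_ge2_subset: "flats_ge2 E indep \<subseteq> Pow E"
proof -
  show "flats_ge2 E indep \<subseteq> Pow E" unfolding flats_ge2_def is_flat_def by auto
  thus "finite (flats_ge2 E indep)" using finite_E finite_subset by blast
qed

lemma lookup_volume_poly:
  "lkp (volume_poly E indep d) m = (if m \<in> deg_monomials (flats_ge2 E indep) d
    then fact d / mfact m * of_bool (ptruncs_rank E r m = 1) else 0)"
proof -
  let ?L = "\<Sum>F\<in>flats_ge2 E indep. sng (sng F 1) (chow_h E indep F)"
  let ?h = "chow_h E indep"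
  define c where "c = lkp (?L ^ d) m"
  \<comment> \<open>\<open>Poly_Mapping.map\<close> applies the integral to nonzero coefficients
    only; the value 0 at 0 removes this guard.\<close>
  have "chow_integral E indep d 0 = 0"
    using degree_map_sum[OF chow_functional_is_degree_map, of "{}"] by (simp add: chow_integral_eq)
  hence vol: "lkp (volume_poly E indep d) m = chow_integral E indep d c"
    unfolding volume_poly_def c_def by (simp add: Poly_Mapping.map.rep_eq when_def)
  \<comment> \<open>The factorial is invertible as a constant polynomial over the reals, which turns
    the multinomial identity into a formula for the coefficient.\<close>
  have unit: "sng 0 (1 / real (mfact m)) * (of_nat (mfact m) * p) = p" for p :: "'a set rpoly"
  proof -
    have "sng 0 (1 / real (mfact m)) * of_nat (mfact m) = (1 :: 'a set rpoly)"
      using mfact_pos[of m] by (simp add: mult_single flip: single_of_nat)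
    thus ?thesis by (simp flip: mult.assoc)
  qed
  have coeff: "of_nat (mfact m) * c = (if kys m \<subseteq> flats_ge2 E indep \<and> mdeg m = d
      then of_nat (fact d) * mon_prod ?h m else 0)"
    unfolding c_def by (rule multinomial_coefficients[OF finite_flats_ge2])
  show ?thesis
  proof (cases "m \<in> deg_monomials (flats_ge2 E indep) d")
    case True
    obtain Fs where m: "m = monomial Fs" by (rule monomial_exhaust)
    have Fs: "set Fs \<subseteq> flats_ge2 E indep" "length Fs = d"
      using True unfolding m monomial_in_deg_monomials by auto
    have "c = sng 0 (1 / real (mfact m)) * (of_nat (fact d) * mon_prod ?h m)"
      using unit[of c] coeff Fs by (simp add: m)
    also have "of_nat (fact d) * mon_prod ?h m = sng 0 (fact d) * mon_prod ?h m"
      by (simp flip: single_of_nat)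
    also have "sng 0 (1 / real (mfact m)) * \<dots> = sng 0 (fact d / real (mfact m)) * mon_prod ?h m"
      by (simp add: mult_single flip: mult.assoc)
    finally have c: "c = sng 0 (fact d / real (mfact m)) * prod_list (map ?h Fs)"
      by (simp add: m mon_prod_monomial)
    have "chow_integral E indep d c
        = fact d / real (mfact m) * chow_integral E indep d (prod_list (map ?h Fs))"
      unfolding c chow_integral_eq
      using degree_map_scale[OF chow_functional_is_degree_map] chow_deg_h_product[of Fs] Fs(2) by simp
    thus ?thesis
      using True unfolding vol chow_integral_h_product[OF Fs] by (simp add: m ptruncs_rank_monomial[OF rank_fun_r])
  next
    case False
    hence "of_nat (mfact m) * c = 0" using coeff unfolding deg_monomials_def by auto
    hence "c = 0" using unit[of c] by simp
    thus ?thesis using False vol \<open>chow_integral E indep d 0 = 0\<close> by simp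
  qed
qed

text \<open>Ensures that the Hessians are not empty matrices, which would have no positive
  eigenvalue.\<close>

lemma ground_in_flats_ge2: "1 \<le> d \<Longrightarrow> E \<in> flats_ge2 E indep"
  unfolding flats_ge2_def is_flat_def using rank_E by simp

end

theorem theorem5p13:
  fixes E :: "'a set" and indep :: "'a set \<Rightarrow> bool" and d :: nat
  assumes "matroid E indep" and "loopless E indep" and "mrank indep E = d + 1"
  shows "lorentzian (flats_ge2 E indep) d (volume_poly E indep d)"
proof -
  interpret loopless_matroid E indep d by unfold_locales fact+
  show ?thesis
    using ground_in_flats_ge2
    by (intro lorentzian_truncation_polynomial[OF rank_fun_r E_nonempty finite_flats_ge2 flats_ge2_subset rank_E
      _ lookup_volume_poly]) auto
qed

end
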